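(* Let $\Phi^h$ be the cumulative offer mechanism under the profile of aggregate choice rules $(\mathcal{C}^h_s)_{s\in S}$. Then $\Phi^h$ is stable with respect to $(\mathcal{C}^h_s)_{s\in S}$, strategy-proof for individuals, and eliminates justified envy.
   Context: Model. $I$ finite set of individuals, $S$ finite set of institutions. Reserve categories $R=\{SC,ST,OBC,EWS\}$, position types $V=\{o\}\cup R$ ($o$ = open). Institution $s$ has $q_s^r$ positions reserved for $r\in R$ and $q_s^o$ open positions. Individual $i$ has vertical membership $t(i)\in R\cup\{g\}$ ($g$ = general). Institution $s$ has a strict merit ranking $\succ_s$ of $I$. Contracts $X$: triples $(i,s,v)$ with $v=o$, or $v=t(i)$ if $t(i)\in R$; $\mathbf{i}(x),\mathbf{s}(x),\mathbf{t}(x)$ denote individual, institution, category; $Y_i,Y_s$ are the contracts of $Y$ involving $i$, resp. $s$; $\mathbf{i}(Y)=\{\mathbf{i}(x):x\in Y\}$. Each $i$ has a strict preference $P_i$ over pairs $(s,v)$ with $(i,s,v)\in X$ and the outside option $\emptyset$ ($R_i$ its weak version); $\mathcal{P}_i$ is the set of all such preferences. $H=\{h_1,\dots,h_L\}$ horizontal types, $\rho(i)\subseteq H$ types of $i$, $\rho^{-1}(h)=\{i:h\in\rho(i)\}$; hierarchical: if $\rho^{-1}(h)\cap\rho^{-1}(h')\neq\emptyset$ then one is a strict subset of the other ($h$ contains $h'$ if $\rho^{-1}(h')\subsetneq\rho^{-1}(h)$). For each $s$, $v$, reservations $\kappa^s_v\in\mathbb{Z}_+^L$; chosen individuals count against all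 their types. Hierarchical choice rule $C^h(A,\kappa,\rho)$ with capacity $q$ and ranking $\succ$: Step 1: let $H^1$ be the types containing no other type. If no individual in $A$ has a type, choose the $\min(q,|A|)$ highest-ranked and stop. Otherwise, for each $h_j\in H^1$ (fixed order, not exceeding remaining positions), choose all not-yet-chosen type-$h_j$ individuals of $A$ if at most $\kappa_j$, else the $\kappa_j$ highest-ranked; reduce remaining positions and the reservation of every type containing $h_j$ by the number chosen (floored at 0); remove $h_j$. Step $n\ge2$: stop if nothing remains; if no type remains, fill remaining positions by rank and stop; otherwise process remaining types containing no other remaining type as in Step 1. Output: all chosen individuals. Aggregate rule $\mathcal{C}^h_s$: process categories in order $o,SC,ST,OBC,EWS$; for category $v$, let $A_v$ be the individuals with a contract $(i,s,v)\in Y$ not chosen by an earlier category; apply $C^h(A_v,\kappa^s_v,\rho)$ with capacity $q^v_s$ and ranking $\succ_s$; select the contracts $(i,s,v)$ of the chosen; $\mathcal{C}^h_s(Y)$ is the union. Cumulative offer mechanism: at each step some individual for whom no institution currently holds a contract proposes her most-preferred acceptable contract not yet proposed; the institution $s$ receiving it holds $\mathcal{C}^h_s(A_s)$, where $A_s$ is the cumulative set of contracts ever proposed to $s$, and other institutions keep their held sets; the process ends when no individual can propose, and the outcome $\Phi^h(P)$ is the set of held contracts (it does not depend on the proposal order). A matching: each individual has at most one contract; feasible if category capacities are respected; $Y_i$ identified with $i$'s pair $(s,v)$ or $\emptyset$. Stable w.r.t. $(C_s)$: (1) $Y_iR_i\emptyset$ for all $i$; (2) $C_s(Y)=Y_s$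 for all $s$; (3) no nonempty $Z\subseteq X\setminus Y$ with $Z_s\subseteq C_s(Y\cup Z)$ for all $s\in\mathbf{s}(Z)$ and each $i\in\mathbf{i}(Z)$ having a single contract in $Z$ strictly preferred to $Y_i$. Eliminates justified envy: for every $j$ and $x\in Y\setminus Y_j$, $(\mathbf{s}(x),\mathbf{t}(x))P_jY_j$ implies $\mathbf{i}(x)\succ_{\mathbf{s}(x)}j$ or $\rho(j)\not\supseteq\rho(\mathbf{i}(x))$. A mechanism has a property if its outcome has it for every preference profile. Strategy-proof: for every profile $P$, individual $i$ and $\tilde P_i\in\mathcal{P}_i$, it is not the case that $\Phi^h(\tilde P_i,P_{-i})_i\,P_i\,\Phi^h(P)_i$. *)

theory Defs
  imports Main
begin

datatype cat = SC | ST | OBC | EWS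
datatype pos = Open | Res cat

text \<open>Vertical membership t(i): None = general (g), Some c = member of reserve category c.
  Contracts are triples (i, s, v).\<close>
definition contracts :: "('i \<Rightarrow> cat option) \<Rightarrow> ('i \<times> 's \<times> pos) set" where
  "contracts t = {(i, s, v). v = Open \<or> (\<exists>c. v = Res c \<and> t i = Some c)}"

definition indiv :: "'i \<times> 's \<times> pos \<Rightarrow> 'i" where "indiv x = fst x"
definition inst :: "'i \<times> 's \<times> pos \<Rightarrow> 's" where "inst x = fst (snd x)"
definition ctype :: "'i \<times> 's \<times> pos \<Rightarrow> pos" where "ctype x = snd (snd x)"
definition pr :: "'i \<times> 's \<times> pos \<Rightarrow> ('s \<times> pos)" where "pr x = (inst x, ctype x)"

definition at_inst :: "('i \<times> 's \<times> pos) set \<Rightarrow> 's \<Rightarrow> ('i \<times> 's \<times> pos) set" where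
  "at_inst Y s = {x \<in> Y. inst x = s}"

text \<open>Merit rankings: rk s i j means i is ranked strictly above j by s.\<close>
definition strict_ranking :: "('i \<Rightarrow> 'i \<Rightarrow> bool) \<Rightarrow> bool" where
  "strict_ranking P \<longleftrightarrow> (\<forall>a. \<not> P a a) \<and> (\<forall>a b c. P a b \<longrightarrow> P b c \<longrightarrow> P a c)
      \<and> (\<forall>a b. a \<noteq> b \<longrightarrow> P a b \<or> P b a)"

text \<open>Preferences of individual i: a strict (linear) order on the options of i, namely
  None (outside option) and Some (s,v) with (i,s,v) a contract. Pf a b means a P_i b.\<close>
definition options :: "('i \<Rightarrow> cat option) \<Rightarrow> 'i \<Rightarrow> ('s \<times> pos) option set" where
  "options t i = insert None {Some (s, v) | s v. (i, s, v) \<in> contracts t}"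

definition is_pref :: "('i \<Rightarrow> cat option) \<Rightarrow> 'i
    \<Rightarrow> (('s \<times> pos) option \<Rightarrow> ('s \<times> pos) option \<Rightarrow> bool) \<Rightarrow> bool" where
  "is_pref t i R \<longleftrightarrow> (\<forall>a b. R a b \<longrightarrow> a \<in> options t i \<and> b \<in> options t i)
      \<and> (\<forall>a. \<not> R a a) \<and> (\<forall>a b c. R a b \<longrightarrow> R b c \<longrightarrow> R a c)
      \<and> (\<forall>a\<in>options t i. \<forall>b\<in>options t i. a \<noteq> b \<longrightarrow> R a b \<or> R b a)"

definition is_profile :: "('i \<Rightarrow> cat option)
    \<Rightarrow> ('i \<Rightarrow> ('s \<times> pos) option \<Rightarrow> ('s \<times> pos) option \<Rightarrow> bool) \<Rightarrow> bool" where
  "is_profile t Pf \<longleftrightarrow> (\<forall>i. is_pref t i (Pf i))"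

definition asg :: "('i \<times> 's \<times> pos) set \<Rightarrow> 'i \<Rightarrow> ('s \<times> pos) option" where
  "asg Y i = (if \<exists>x\<in>Y. indiv x = i then Some (pr (SOME x. x \<in> Y \<and> indiv x = i)) else None)"

definition is_matching :: "('i \<Rightarrow> cat option) \<Rightarrow> ('i \<times> 's \<times> pos) set \<Rightarrow> bool" where
  "is_matching t Y \<longleftrightarrow> Y \<subseteq> contracts t \<and> (\<forall>x\<in>Y. \<forall>y\<in>Y. indiv x = indiv y \<longrightarrow> x = y)"

definition type_ext :: "('i \<Rightarrow> 'h set) \<Rightarrow> 'h \<Rightarrow> 'i set" where
  "type_ext \<rho> h = {i. h \<in> \<rho> i}"

definition hcontains :: "('i \<Rightarrow> 'h set) \<Rightarrow> 'h \<Rightarrow> 'h \<Rightarrow> bool" where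
  "hcontains \<rho> h h' \<longleftrightarrow> type_ext \<rho> h' \<subset> type_ext \<rho> h"

definition hierarchical :: "('i \<Rightarrow> 'h set) \<Rightarrow> bool" where
  "hierarchical \<rho> \<longleftrightarrow> (\<forall>h h'. h \<noteq> h' \<longrightarrow> type_ext \<rho> h \<inter> type_ext \<rho> h' \<noteq> {} \<longrightarrow>
      type_ext \<rho> h \<subset> type_ext \<rho> h' \<or> type_ext \<rho> h' \<subset> type_ext \<rho> h)"

definition top_k :: "('i \<Rightarrow> 'i \<Rightarrow> bool) \<Rightarrow> nat \<Rightarrow> 'i set \<Rightarrow> 'i set" where
  "top_k P k A = {i \<in> A. card {j \<in> A. P j i} < k}"

text \<open>Processing of one type h: state = (chosen, remaining positions, current reservations).
  Chooses the min(remaining positions, reservation) highest-ranked not-yet-chosen type-h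
  individuals of A (all of them if there are not more), and reduces remaining positions
  and the reservation of every type containing h by the number chosen (floored at 0).\<close>
definition proc_type :: "'i set \<Rightarrow> ('i \<Rightarrow> 'i \<Rightarrow> bool) \<Rightarrow> ('i \<Rightarrow> 'h set) \<Rightarrow> 'h
    \<Rightarrow> 'i set \<times> nat \<times> ('h \<Rightarrow> nat) \<Rightarrow> 'i set \<times> nat \<times> ('h \<Rightarrow> nat)" where
  "proc_type A P \<rho> h st = (case st of (C, r, k) \<Rightarrow>
     (let N = top_k P (min r (k h)) {i \<in> A - C. h \<in> \<rho> i}
      in (C \<union> N, r - card N, \<lambda>h'. if hcontains \<rho> h' h then k h' - card N else k h')))"

definition hstep :: "'i set \<Rightarrow> ('i \<Rightarrow> 'i \<Rightarrow> bool) \<Rightarrow> ('i \<Rightarrow> 'h::{finite,linorder} set)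
    \<Rightarrow> 'i set \<times> nat \<times> ('h \<Rightarrow> nat) \<times> 'h set \<Rightarrow> 'i set \<times> nat \<times> ('h \<Rightarrow> nat) \<times> 'h set" where
  "hstep A P \<rho> st = (case st of (C, r, k, T) \<Rightarrow>
     (let M = {h \<in> T. \<not> (\<exists>h'\<in>T. hcontains \<rho> h h')}
      in (case fold (proc_type A P \<rho>) (sorted_list_of_set M) (C, r, k) of
            (C', r', k') \<Rightarrow> (C', r', k', T - M))))"

text \<open>C^h(A, kappa, rho) with capacity q and ranking P. The horizontal types are all elements
  of the finite type 'h, ordered h_1 < ... < h_L by its linear order. Each step removes at least
  one type, so after card(UNIV::'h set) steps no type remains; then remaining positions are filled by rank.\<close>
definition hchoice :: "'i set \<Rightarrow> ('i \<Rightarrow> 'i \<Rightarrow> bool) \<Rightarrow> ('i \<Rightarrow> 'h::{finite,linorder} set)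
    \<Rightarrow> nat \<Rightarrow> ('h \<Rightarrow> nat) \<Rightarrow> 'i set" where
  "hchoice A P \<rho> q \<kappa> =
     (if \<forall>i\<in>A. \<rho> i = {} then top_k P q A
      else (case (hstep A P \<rho> ^^ card (UNIV :: 'h set)) ({}, q, \<kappa>, UNIV) of
              (C, r, _, _) \<Rightarrow> C \<union> top_k P r (A - C)))"

definition cat_order :: "pos list" where
  "cat_order = [Open, Res SC, Res ST, Res OBC, Res EWS]"

definition agg_choice :: "('s \<Rightarrow> pos \<Rightarrow> nat) \<Rightarrow> ('s \<Rightarrow> pos \<Rightarrow> 'h \<Rightarrow> nat)
    \<Rightarrow> ('s \<Rightarrow> 'i \<Rightarrow> 'i \<Rightarrow> bool) \<Rightarrow> ('i \<Rightarrow> 'h::{finite,linorder} set)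
    \<Rightarrow> 's \<Rightarrow> ('i \<times> 's \<times> pos) set \<Rightarrow> ('i \<times> 's \<times> pos) set" where
  "agg_choice q \<kappa> rk \<rho> s Y = snd (fold (\<lambda>v (D, Z).
       (let Av = {i. (i, s, v) \<in> Y} - D;
            Cv = hchoice Av (rk s) \<rho> (q s v) (\<kappa> s v)
        in (D \<union> Cv, Z \<union> {(i, s, v) | i. i \<in> Cv}))) cat_order ({}, {}))"

text \<open>State = set A of all contracts proposed so far; institution s holds C_s(A_s).\<close>
definition held :: "('s \<Rightarrow> ('i \<times> 's \<times> pos) set \<Rightarrow> ('i \<times> 's \<times> pos) set)
    \<Rightarrow> ('i \<times> 's \<times> pos) set \<Rightarrow> ('i \<times> 's \<times> pos) set" where
  "held C A = (\<Union>s. C s (at_inst A s))"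

definition best_new :: "('i \<Rightarrow> cat option) \<Rightarrow> ('i \<Rightarrow> ('s \<times> pos) option \<Rightarrow> ('s \<times> pos) option \<Rightarrow> bool)
    \<Rightarrow> ('i \<times> 's \<times> pos) set \<Rightarrow> 'i \<Rightarrow> ('i \<times> 's \<times> pos) \<Rightarrow> bool" where
  "best_new t Pf A i x \<longleftrightarrow> x \<in> contracts t \<and> indiv x = i \<and> x \<notin> A \<and> Pf i (Some (pr x)) None
     \<and> (\<forall>y\<in>contracts t. indiv y = i \<longrightarrow> y \<notin> A \<longrightarrow> Pf i (Some (pr y)) None \<longrightarrow> y \<noteq> x
          \<longrightarrow> Pf i (Some (pr x)) (Some (pr y)))"

definition co_step :: "('s \<Rightarrow> ('i \<times> 's \<times> pos) set \<Rightarrow> ('i \<times> 's \<times> pos) set) \<Rightarrow> ('i \<Rightarrow> cat option)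
    \<Rightarrow> ('i \<Rightarrow> ('s \<times> pos) option \<Rightarrow> ('s \<times> pos) option \<Rightarrow> bool)
    \<Rightarrow> ('i \<times> 's \<times> pos) set \<Rightarrow> ('i \<times> 's \<times> pos) set \<Rightarrow> bool" where
  "co_step C t Pf A A' \<longleftrightarrow> (\<exists>i x. i \<notin> indiv ` held C A \<and> best_new t Pf A i x \<and> A' = insert x A)"

definition co_outcome :: "('s \<Rightarrow> ('i \<times> 's \<times> pos) set \<Rightarrow> ('i \<times> 's \<times> pos) set) \<Rightarrow> ('i \<Rightarrow> cat option)
    \<Rightarrow> ('i \<Rightarrow> ('s \<times> pos) option \<Rightarrow> ('s \<times> pos) option \<Rightarrow> bool)
    \<Rightarrow> ('i \<times> 's \<times> pos) set \<Rightarrow> bool" where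
  "co_outcome C t Pf Y \<longleftrightarrow> (\<exists>A. (co_step C t Pf)\<^sup>*\<^sup>* {} A \<and> \<not> (\<exists>A'. co_step C t Pf A A')
       \<and> Y = held C A)"

definition stable :: "('s \<Rightarrow> ('i \<times> 's \<times> pos) set \<Rightarrow> ('i \<times> 's \<times> pos) set) \<Rightarrow> ('i \<Rightarrow> cat option)
    \<Rightarrow> ('i \<Rightarrow> ('s \<times> pos) option \<Rightarrow> ('s \<times> pos) option \<Rightarrow> bool)
    \<Rightarrow> ('i \<times> 's \<times> pos) set \<Rightarrow> bool" where
  "stable C t Pf Y \<longleftrightarrow> is_matching t Y
     \<and> (\<forall>i. asg Y i = None \<or> Pf i (asg Y i) None)
     \<and> (\<forall>s. C s Y = at_inst Y s)
     \<and> \<not> (\<exists>Z. Z \<noteq> {} \<and> Z \<subseteq> contracts t - Y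
            \<and> (\<forall>s\<in>inst ` Z. at_inst Z s \<subseteq> C s (Y \<union> Z))
            \<and> (\<forall>i\<in>indiv ` Z. \<exists>x. {z \<in> Z. indiv z = i} = {x} \<and> Pf i (Some (pr x)) (asg Y i)))"

definition no_justified_envy :: "('i \<Rightarrow> ('s \<times> pos) option \<Rightarrow> ('s \<times> pos) option \<Rightarrow> bool)
    \<Rightarrow> ('s \<Rightarrow> 'i \<Rightarrow> 'i \<Rightarrow> bool) \<Rightarrow> ('i \<Rightarrow> 'h set) \<Rightarrow> ('i \<times> 's \<times> pos) set \<Rightarrow> bool" where
  "no_justified_envy Pf rk \<rho> Y \<longleftrightarrow> (\<forall>j. \<forall>x\<in>Y. indiv x \<noteq> j \<longrightarrow> Pf j (Some (pr x)) (asg Y j)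
      \<longrightarrow> rk (inst x) (indiv x) j \<or> \<not> (\<rho> (indiv x) \<subseteq> \<rho> j))"

end

theory Submission
  imports Defs
begin

text \<open>
  For a single category the hierarchical rule fills reservations along a list of types in which every
  type comes after those it contains. Comparing its runs on A and on A with one more applicant j, the
  chosen sets always agree up to adding j, or adding j and dropping one applicant m; once m is
  dropped, j and m belong to exactly the same types still to be processed. Hence the rule is
  substitutable, size monotonic and insensitive to rejected applicants.

  Letting every category choose independently gives a substitutable, size monotonic completion of
  the aggregate rule: the two coincide as soon as nobody is chosen by two categories, which never
  happens along the cumulative offer process. Under the completion, the set of offers made is the least
  set that is closed under rejection, whatever the proposal order. Stability follows from
  irrelevance of rejected contracts. For strategy-proofness, suppose that misreporting secures w. Then
  w is also secured by reporting w alone as acceptable, whereas truncating the true preference at w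
  leaves the individual unmatched; size monotonicity makes these two facts incompatible.
\<close>

section \<open>The hierarchical choice rule\<close>

lemma strict_rankingD:
  assumes "strict_ranking P"
  shows "\<not> P a a" "P a b \<Longrightarrow> P b c \<Longrightarrow> P a c" "a \<noteq> b \<Longrightarrow> P a b \<or> P b a"
  using assms unfolding strict_ranking_def by blast+

lemma top_k_subset: "top_k P k A \<subseteq> A"
  by (auto simp: top_k_def)

text \<open>A higher-ranked element has a strictly smaller set above it, so positions are distinct;
  being \<open>card A\<close> distinct numbers below \<open>card A\<close>, they exhaust that
  range.\<close>

lemma rank_position_bij:
  assumes P: "strict_ranking P" and A: "finite A"
  shows "bij_betw (\<lambda>i. card {j \<in> A. P j i}) A {..<card A}"
proof -
  let ?f = "\<lambda>i. card {j \<in> A. P j i}"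
  have less: "?f a < ?f b" if "P a b" "a \<in> A" for a b
  proof (rule psubset_card_mono)
    show "{j \<in> A. P j a} \<subset> {j \<in> A. P j b}"
      using that strict_rankingD[OF P] by blast
  qed (use A in simp)
  have inj: "inj_on ?f A"
  proof (rule inj_onI, rule ccontr)
    fix a b assume "a \<in> A" "b \<in> A" "?f a = ?f b" "a \<noteq> b"
    then show False using less[of a b] less[of b a] strict_rankingD(3)[OF P, of a b] by auto
  qed
  have "?f ` A \<subseteq> {..<card A}"
  proof clarsimp
    fix i assume "i \<in> A"
    then have "{j \<in> A. P j i} \<subset> A" using strict_rankingD(1)[OF P] by blast
    then show "?f i < card A" using A psubset_card_mono by blast
  qed
  then have "?f ` A = {..<card A}"
    by (simp add: card_image card_subset_eq inj)
  with inj show ?thesis by (simp add: bij_betw_def)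
qed

lemma card_top_k:
  assumes "strict_ranking P" "finite A"
  shows "card (top_k P k A) = min k (card A)"
proof -
  let ?f = "\<lambda>i. card {j \<in> A. P j i}"
  have bij: "bij_betw ?f A {..<card A}" by (rule rank_position_bij[OF assms])
  have "?f ` top_k P k A = {..<min k (card A)}"
  proof -
    have "?f ` top_k P k A = ?f ` A \<inter> {..<k}" by (auto simp: top_k_def)
    also have "\<dots> = {..<min k (card A)}" using bij by (auto simp: bij_betw_def)
    finally show ?thesis .
  qed
  moreover have "inj_on ?f (top_k P k A)"
    by (rule inj_on_subset[OF bij_betw_imp_inj_on[OF bij] top_k_subset])
  ultimately show ?thesis using card_image by fastforce
qed

text \<open>A newcomer can only push the others down, so nobody from A enters; the two selections
  have almost equal size, so at most one element leaves.\<close>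

lemma top_k_insert:
  assumes P: "strict_ranking P" and A: "finite A" and m: "m \<notin> A"
  shows "top_k P k (insert m A) = top_k P k A \<or> top_k P k (insert m A) = insert m (top_k P k A)
    \<or> (\<exists>l\<in>top_k P k A. top_k P k (insert m A) = insert m (top_k P k A - {l}))"
proof -
  let ?T = "top_k P k A" and ?T' = "top_k P k (insert m A)"
  have fin: "finite ?T" "finite ?T'" using A by (auto intro: finite_subset[OF top_k_subset])
  have mT: "m \<notin> ?T" using m top_k_subset[of P k A] by blast
  have "card {j \<in> A. P j i} \<le> card {j \<in> insert m A. P j i}" for i
    by (rule card_mono) (use A in auto)
  then have sub: "?T' - {m} \<subseteq> ?T" unfolding top_k_def by (auto intro: le_less_trans)
  have c: "card ?T = min k (card A)" "card ?T' = min k (Suc (card A))"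
    using card_top_k[OF P] A m by auto
  show ?thesis
  proof (cases "m \<in> ?T'")
    case False
    then have "?T' \<subseteq> ?T" using sub by blast
    then have "?T' = ?T" using c fin by (intro card_seteq) auto
    then show ?thesis by blast
  next
    case True
    have "card (?T - (?T' - {m})) \<le> 1"
      using sub fin True c by (simp add: card_Diff_subset)
    then consider "?T - (?T' - {m}) = {}" | l where "?T - (?T' - {m}) = {l}"
      using fin by (metis One_nat_def card_0_eq card_1_singletonE finite_Diff le_SucE le_zero_eq)
    then show ?thesis
    proof cases
      case 1 then have "?T' = insert m ?T" using sub True by blast
      then show ?thesis by blast
    next
      case 2
      then have "?T' = insert m (?T - {l})" "l \<in> ?T" using sub True mT by blast+
      then show ?thesis by blast
    qed
  qed
qed

text \<open>The effect of losing one seat. The cardinality clause later shows that whoever is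
  dropped for lack of capacity is dropped in a full run.\<close>

lemma top_k_Suc:
  assumes P: "strict_ranking P" and A: "finite A"
  shows "top_k P k A = top_k P (Suc k) A \<or> (\<exists>l\<in>top_k P (Suc k) A.
    top_k P k A = top_k P (Suc k) A - {l} \<and> card (top_k P (Suc k) A) = Suc k)"
proof -
  let ?T = "top_k P (Suc k) A" and ?T' = "top_k P k A"
  have fin: "finite ?T" "finite ?T'" using A by (auto intro: finite_subset[OF top_k_subset])
  have sub: "?T' \<subseteq> ?T" by (auto simp: top_k_def)
  have c: "card ?T = min (Suc k) (card A)" "card ?T' = min k (card A)"
    using card_top_k[OF P A] by auto
  show ?thesis
  proof (cases "Suc k \<le> card A")
    case True
    then have "card (?T - ?T') = 1" using sub fin c by (simp add: card_Diff_subset)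
    then obtain l where "?T - ?T' = {l}" using card_1_singletonE by blast
    then have "l \<in> ?T" "?T' = ?T - {l}" using sub by blast+
    then show ?thesis using c True by auto
  next
    case False
    then have "?T' = ?T" using c fin sub by (intro card_seteq) auto
    then show ?thesis by blast
  qed
qed

section \<open>Filling reservations along a nested list of types\<close>

lemma card_swap:
  assumes "finite C" "m \<in> C" "j \<notin> C"
  shows "card (insert j (C - {m})) = card C"
proof -
  have "card (insert j (C - {m})) = Suc (card (C - {m}))"
    using assms by (intro card_insert_disjoint) auto
  also have "\<dots> = card C" by (rule card_Suc_Diff1[OF assms(1,2)])
  finally show ?thesis .
qed

text \<open>The current reservation and the remaining capacity are functions of the set C chosen so far,
  so C alone is the state. An entry (E, n) is a type with extension E and reservation n.\<close>
definition slot_step :: "('i \<Rightarrow> 'i \<Rightarrow> bool) \<Rightarrow> nat \<Rightarrow> 'i set \<Rightarrow> 'i set \<times> nat \<Rightarrow> 'i set \<Rightarrow> 'i set" where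
  "slot_step P q A = (\<lambda>(E, n) C.
     C \<union> top_k P (min (q - card C) (n - card (C \<inter> E))) ((A - C) \<inter> E))"

definition slot_run :: "('i \<Rightarrow> 'i \<Rightarrow> bool) \<Rightarrow> nat \<Rightarrow> ('i set \<times> nat) list \<Rightarrow> 'i set \<Rightarrow> 'i set" where
  "slot_run P q L A = fold (slot_step P q A) L {}"

text \<open>Encodes that a type comes after those it contains. The consequence used is that two
  members of E belong to the same later types.\<close>

definition nested_order :: "('i set \<times> nat) list \<Rightarrow> bool" where
  "nested_order = sorted_wrt (\<lambda>(E, n) (F, n'). E \<subseteq> F \<or> E \<inter> F = {})"

text \<open>Invariant relating the state C of the run on A to the state C' of the run with j added,
  where L is still to be processed. After a swap, either the capacity is exhausted and nothing more
  is chosen, or no type in L distinguishes j from the dropped m.\<close>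

definition differ_by :: "nat \<Rightarrow> ('i set \<times> nat) list \<Rightarrow> 'i \<Rightarrow> 'i set \<Rightarrow> 'i set \<Rightarrow> bool" where
  "differ_by q L j C C' \<longleftrightarrow> C' = C \<or> C' = insert j C \<or>
     (\<exists>m\<in>C. C' = insert j (C - {m}) \<and>
        (q \<le> card C \<or> (\<forall>(E, n) \<in> set L. j \<in> E \<longleftrightarrow> m \<in> E)))"

lemma slot_step_subset: "C \<subseteq> A \<Longrightarrow> slot_step P q A e C \<subseteq> A"
  by (auto simp: slot_step_def top_k_def split: prod.splits)

lemma card_slot_step:
  fixes A :: "'i::finite set"
  assumes "strict_ranking P" "card C \<le> q"
  shows "card (slot_step P q A e C) \<le> q"
proof -
  obtain E n where e: "e = (E, n)" by (cases e)
  let ?T = "top_k P (min (q - card C) (n - card (C \<inter> E))) ((A - C) \<inter> E)"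
  have "card ?T \<le> q - card C" using card_top_k[OF assms(1)] by (simp add: min.coboundedI1)
  then have "card (C \<union> ?T) \<le> q" using card_Un_le[of C ?T] assms(2) by linarith
  then show ?thesis by (simp add: slot_step_def e)
qed

lemma differ_by_swap:
  assumes "m \<in> C" "C' = insert j (C - {m})"
    and "q \<le> card C \<or> (\<forall>(E, n) \<in> set L. j \<in> E \<longleftrightarrow> m \<in> E)"
  shows "differ_by q L j C C'"
  using assms unfolding differ_by_def by blast

text \<open>In every case the pools for E, or else the quotas, differ by at most one, so
  \<open>top_k_insert\<close> or \<open>top_k_Suc\<close> bounds the change. Whoever is displaced
  from E by another member of E shares all later types with it, which restores the
  invariant.\<close>

lemma slot_step_differ_by:
  fixes A :: "'i::finite set"
  assumes P: "strict_ranking P" and j: "j \<notin> A" and C: "C \<subseteq> A"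
    and q: "card C \<le> q" "card C' \<le> q"
    and nest: "nested_order ((E, n) # L)" and d: "differ_by q ((E, n) # L) j C C'"
  shows "differ_by q L j (slot_step P q A (E, n) C) (slot_step P q (insert j A) (E, n) C')"
proof -
  let ?k = "min (q - card C) (n - card (C \<inter> E))"
  let ?k' = "min (q - card C') (n - card (C' \<inter> E))"
  let ?R = "(A - C) \<inter> E" and ?R' = "(insert j A - C') \<inter> E"
  define T where "T = top_k P ?k ?R"
  define T' where "T' = top_k P ?k' ?R'"
  have jC: "j \<notin> C" using j C by blast
  have TR: "T \<subseteq> ?R" unfolding T_def by (rule top_k_subset)
  have step: "slot_step P q A (E, n) C = C \<union> T" "slot_step P q (insert j A) (E, n) C' = C' \<union> T'"
    by (auto simp: slot_step_def T_def T'_def)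
  have later: "j \<in> F \<longleftrightarrow> l \<in> F" if "j \<in> E" "l \<in> E" "(F, n') \<in> set L" for F n' l
    using nest that unfolding nested_order_def by fastforce
  have d': "C' = C \<or> C' = insert j C \<or>
     (\<exists>m\<in>C. C' = insert j (C - {m}) \<and>
        (q \<le> card C \<or> ((j \<in> E \<longleftrightarrow> m \<in> E) \<and> (\<forall>(E, n) \<in> set L. j \<in> E \<longleftrightarrow> m \<in> E))))"
    using d unfolding differ_by_def by auto
  then consider (same) "C' = C" | (more) "C' = insert j C"
    | (full) m where "m \<in> C" "C' = insert j (C - {m})" "q \<le> card C"
    | (swap) m where "m \<in> C" "C' = insert j (C - {m})" "j \<in> E \<longleftrightarrow> m \<in> E"
        "\<forall>(E, n) \<in> set L. j \<in> E \<longleftrightarrow> m \<in> E"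
    by blast
  then show ?thesis
  proof cases
    case same
    show ?thesis
    proof (cases "j \<in> E")
      case False
      then have "?R' = ?R" using same by blast
      then have "T' = T" using same by (simp add: T_def T'_def)
      then show ?thesis unfolding step using same by (simp add: differ_by_def)
    next
      case True
      then have R': "?R' = insert j ?R" using same jC by blast
      have "j \<notin> ?R" using j by blast
      with top_k_insert[OF P _ this, of ?k, folded T_def] R' same
      consider "T' = T" | "T' = insert j T" | l where "l \<in> T" "T' = insert j (T - {l})"
        by (auto simp: T'_def)
      then show ?thesis
      proof cases
        case 1 then show ?thesis unfolding step using same by (simp add: differ_by_def)
      next
        case 2 then show ?thesis unfolding step using same by (simp add: differ_by_def)
      next
        case 3
        have "l \<in> E" "l \<notin> C" using 3 TR by blast+
        then have "C' \<union> T' = insert j ((C \<union> T) - {l})" "l \<in> C \<union> T" using 3 same jC by blast+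
        moreover have "\<forall>(F, n') \<in> set L. j \<in> F \<longleftrightarrow> l \<in> F" using later True \<open>l \<in> E\<close> by blast
        ultimately show ?thesis unfolding step by (intro differ_by_swap) auto
      qed
    qed
  next
    case more
    have cC': "card C' = Suc (card C)" using more jC by simp
    have R': "?R' = ?R" using more j by blast
    \<comment> \<open>j has used up one seat, and one reserved place of E if it lies in E. If it
      lies outside E, the quota can fall only because the remaining capacity is the binding
      bound.\<close>
    have k: "?k' = ?k \<or> (Suc ?k' = ?k \<and> (j \<in> E \<or> ?k = q - card C))"
    proof (cases "j \<in> E")
      case True
      then have "card (C' \<inter> E) = Suc (card (C \<inter> E))" using more jC by simp
      then show ?thesis using cC' q True by auto
    next
      case False
      then have "card (C' \<inter> E) = card (C \<inter> E)" using more by simp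
      then show ?thesis using cC' q by auto
    qed
    consider "T' = T" | l where "l \<in> T" "T' = T - {l}" "card T = ?k" "j \<in> E \<or> ?k = q - card C"
    proof (cases "?k' = ?k")
      case True
      then have "T' = T" using R' by (simp add: T_def T'_def)
      then show thesis by (rule that(1))
    next
      case False
      then have k: "?k = Suc ?k'" "j \<in> E \<or> ?k = q - card C" using k by simp_all
      show thesis
        using top_k_Suc[OF P finite, of ?k' ?R] that k(2) unfolding T_def T'_def R' k(1)[symmetric] by blast
    qed
    then show ?thesis
    proof cases
      case 1 then show ?thesis unfolding step using more by (simp add: differ_by_def)
    next
      case 2
      have l: "l \<in> E" "l \<notin> C" using 2 TR by blast+
      then have eq: "C' \<union> T' = insert j ((C \<union> T) - {l})" "l \<in> C \<union> T" using 2 more by blast+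
      have "q \<le> card (C \<union> T) \<or> (\<forall>(F, n') \<in> set L. j \<in> F \<longleftrightarrow> l \<in> F)"
      proof (cases "j \<in> E")
        case True then show ?thesis using later l by blast
      next
        case False
        then have "card T = q - card C" using 2 by simp
        moreover have "C \<inter> T = {}" using TR by blast
        ultimately have "card (C \<union> T) = card C + (q - card C)" by (simp add: card_Un_disjoint)
        then have "q \<le> card (C \<union> T)" by linarith
        then show ?thesis ..
      qed
      with eq show ?thesis unfolding step by (intro differ_by_swap)
    qed
  next
    case full
    have "card C' = card C" using full jC by (simp add: card_swap del: card_insert_disjoint)
    then have "T = {}" "T' = {}" using full(3) by (auto simp: T_def T'_def top_k_def)
    then show ?thesis unfolding step using full by (intro differ_by_swap[of m]) auto
  next
    \<comment> \<open>Seats and reservation used are equal on both sides, but m, unchosen in the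
      larger run, is back in its pool if m lies in E. It may then be chosen after all, which leaves
      j as the only difference, or chosen in place of some l.\<close>
    case swap
    have cC: "card C' = card C" using swap jC by (simp add: card_swap del: card_insert_disjoint)
    have cE: "card (C' \<inter> E) = card (C \<inter> E)"
    proof (cases "j \<in> E")
      case True
      then have "C' \<inter> E = insert j (C \<inter> E - {m})" "m \<in> C \<inter> E" using swap by blast+
      then show ?thesis using jC by (simp only:) (intro card_swap, auto)
    next
      case False
      then have "C' \<inter> E = C \<inter> E" using swap by blast
      then show ?thesis by simp
    qed
    have kk: "?k' = ?k" using cC cE by simp
    show ?thesis
    proof (cases "m \<in> E")
      case False
      then have "?R' = ?R" using swap j C by blast
      then have "T' = T" using kk by (simp add: T_def T'_def)
      moreover have "m \<notin> T" using False TR by blast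
      ultimately have "C' \<union> T' = insert j ((C \<union> T) - {m})" using swap by blast
      then show ?thesis unfolding step using swap by (intro differ_by_swap[of m]) auto
    next
      case True
      then have R': "?R' = insert m ?R" using swap j jC C by blast
      have mR: "m \<notin> ?R" using swap by blast
      with top_k_insert[OF P _ this, of ?k, folded T_def] R' kk
      consider "T' = T" | "T' = insert m T" | l where "l \<in> T" "T' = insert m (T - {l})"
        by (auto simp: T'_def)
      then show ?thesis
      proof cases
        case 1
        moreover have "m \<notin> T" using mR TR by blast
        ultimately have "C' \<union> T' = insert j ((C \<union> T) - {m})" using swap by blast
        then show ?thesis unfolding step using swap by (intro differ_by_swap[of m]) auto
      next
        case 2
        then have "C' \<union> T' = insert j (C \<union> T)" using swap by blast
        then show ?thesis unfolding step by (simp add: differ_by_def)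
      next
        case 3
        have "l \<in> E" "l \<notin> C" using 3 TR by blast+
        then have "C' \<union> T' = insert j ((C \<union> T) - {l})" "l \<in> C \<union> T" using 3 swap by blast+
        moreover have "\<forall>(F, n') \<in> set L. j \<in> F \<longleftrightarrow> l \<in> F" using later True swap(3) \<open>l \<in> E\<close> by blast
        ultimately show ?thesis unfolding step by (intro differ_by_swap) auto
      qed
    qed
  qed
qed

lemma fold_slot_step_differ_by:
  fixes A :: "'i::finite set"
  assumes P: "strict_ranking P" and j: "j \<notin> A"
  shows "C \<subseteq> A \<Longrightarrow> card C \<le> q \<Longrightarrow> card C' \<le> q \<Longrightarrow> nested_order L \<Longrightarrow> differ_by q L j C C' \<Longrightarrow>
    differ_by q [] j (fold (slot_step P q A) L C) (fold (slot_step P q (insert j A)) L C')"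
proof (induction L arbitrary: C C')
  case (Cons e L)
  obtain E n where e: "e = (E, n)" by (cases e)
  have "nested_order L" using Cons.prems by (simp add: nested_order_def)
  then show ?case unfolding fold.simps o_apply
    using slot_step_differ_by[OF P j] Cons.prems e
    by (intro Cons.IH slot_step_subset card_slot_step P) auto
qed simp

lemma slot_run_subset: "slot_run P q L A \<subseteq> A"
proof -
  have "C \<subseteq> A \<Longrightarrow> fold (slot_step P q A) L C \<subseteq> A" for C
    by (induction L arbitrary: C) (auto dest: slot_step_subset)
  then show ?thesis by (simp add: slot_run_def)
qed

lemma slot_run_insert:
  fixes A :: "'i::finite set"
  assumes "strict_ranking P" "nested_order L" "j \<notin> A"
  shows "slot_run P q L (insert j A) \<inter> A \<subseteq> slot_run P q L A
    \<and> card (slot_run P q L A) \<le> card (slot_run P q L (insert j A))"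
proof -
  let ?C = "slot_run P q L A" and ?C' = "slot_run P q L (insert j A)"
  have d: "differ_by q [] j ?C ?C'"
    unfolding slot_run_def
    by (rule fold_slot_step_differ_by) (use assms in \<open>auto simp: differ_by_def\<close>)
  have jC: "j \<notin> ?C" using assms(3) slot_run_subset[of P q L A] by blast
  from d consider "?C' = ?C" | "?C' = insert j ?C" | m where "m \<in> ?C" "?C' = insert j (?C - {m})"
    unfolding differ_by_def by blast
  then show ?thesis
  proof cases
    case 3
    then have "card ?C' = card ?C" using jC by (simp add: card_swap del: card_insert_disjoint)
    then show ?thesis using 3 assms(3) by auto
  qed (use jC assms(3) in auto)
qed

lemma slot_run_mono:
  fixes A B :: "'i::finite set"
  assumes P: "strict_ranking P" and L: "nested_order L" and AB: "A \<subseteq> B"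
  shows "slot_run P q L B \<inter> A \<subseteq> slot_run P q L A
    \<and> card (slot_run P q L A) \<le> card (slot_run P q L B)"
proof -
  have "slot_run P q L (A \<union> D) \<inter> A \<subseteq> slot_run P q L A
    \<and> card (slot_run P q L A) \<le> card (slot_run P q L (A \<union> D))" for D
  proof (induction D rule: finite_induct[OF finite])
    case (2 j D)
    show ?case
    proof (cases "j \<in> A \<union> D")
      case True then show ?thesis using 2 by (simp add: insert_absorb)
    next
      case False
      have "A \<union> insert j D = insert j (A \<union> D)" by blast
      moreover note slot_run_insert[OF P L False, of q]
      ultimately show ?thesis using 2(3) by auto
    qed
  qed auto
  from this[of B] show ?thesis using AB by (simp add: Un_absorb1)
qed

text \<open>The implication "i chosen, hence j chosen" survives each step: when i is picked for E, j
  is in E as well, so j is already chosen or stands above i in the same pool.\<close>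

lemma slot_run_priority:
  assumes P: "strict_ranking P" and L: "\<forall>(E, n) \<in> set L. i \<in> E \<longrightarrow> j \<in> E"
    and j: "j \<in> A" "P j i" and i: "i \<in> slot_run P q L A" and fin: "finite A"
  shows "j \<in> slot_run P q L A"
proof -
  have step: "j \<in> slot_step P q A (E, n) C"
    if "i \<in> slot_step P q A (E, n) C" "i \<in> C \<longrightarrow> j \<in> C" "i \<in> E \<longrightarrow> j \<in> E" for E n C
  proof (cases "j \<in> C")
    case False
    let ?R = "(A - C) \<inter> E"
    let ?k = "min (q - card C) (n - card (C \<inter> E))"
    have iT: "i \<in> top_k P ?k ?R" using that False by (auto simp: slot_step_def)
    then have "j \<in> ?R" using j that False by (auto simp: top_k_def)
    moreover have "card {l \<in> ?R. P l j} \<le> card {l \<in> ?R. P l i}"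
      by (rule card_mono) (use fin j strict_rankingD(2)[OF P] in auto)
    ultimately show ?thesis using iT by (auto simp: slot_step_def top_k_def)
  qed (simp add: slot_step_def)
  have "i \<in> C \<longrightarrow> j \<in> C \<Longrightarrow> i \<in> fold (slot_step P q A) L C \<Longrightarrow> j \<in> fold (slot_step P q A) L C" for C
    using L
  proof (induction L arbitrary: C)
    case (Cons e L)
    obtain E n where e: "e = (E, n)" by (cases e)
    have "i \<in> slot_step P q A e C \<longrightarrow> j \<in> slot_step P q A e C"
      using Cons.prems step[of E n C] e by auto
    then show ?case using Cons.prems Cons.IH[of "slot_step P q A e C"] by simp
  qed simp
  then show ?thesis using i by (simp add: slot_run_def)
qed

section \<open>The hierarchical rule as a run along one list of types\<close>

primrec type_order :: "('i \<Rightarrow> 'h::{finite,linorder} set) \<Rightarrow> nat \<Rightarrow> 'h set \<Rightarrow> 'h list" where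
  "type_order \<rho> 0 T = []"
| "type_order \<rho> (Suc n) T = (let M = {h \<in> T. \<not> (\<exists>h'\<in>T. hcontains \<rho> h h')}
     in sorted_list_of_set M @ type_order \<rho> n (T - M))"

lemma set_type_order: "set (type_order \<rho> n T) \<subseteq> T"
  by (induction n arbitrary: T) (fastforce simp: Let_def)+

text \<open>The types handled in a round are minimal in T, and all later ones are taken from T minus
  that round, so none of them is contained in an earlier one.\<close>

lemma sorted_type_order:
  "sorted_wrt (\<lambda>h h'. h \<noteq> h' \<and> \<not> hcontains \<rho> h h') (type_order \<rho> n T)"
proof (induction n arbitrary: T)
  case (Suc n)
  let ?M = "{h \<in> T. \<not> (\<exists>h'\<in>T. hcontains \<rho> h h')}"
  have 1: "sorted_wrt (\<lambda>h h'. h \<noteq> h' \<and> \<not> hcontains \<rho> h h') (sorted_list_of_set ?M)"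
    by (rule sorted_wrt_mono_rel[OF _ strict_sorted_list_of_set]) auto
  have 2: "\<forall>h\<in>set (sorted_list_of_set ?M). \<forall>h'\<in>set (type_order \<rho> n (T - ?M)).
      h \<noteq> h' \<and> \<not> hcontains \<rho> h h'"
    using set_type_order[of \<rho> n "T - ?M"] by auto
  show ?case
    unfolding type_order.simps Let_def sorted_wrt_append by (intro conjI 1 2 Suc)
qed simp

lemma hstep_funpow:
  "\<exists>T'. (hstep A P \<rho> ^^ n) (C, r, k, T) =
     (case fold (proc_type A P \<rho>) (type_order \<rho> n T) (C, r, k) of (C', r', k') \<Rightarrow> (C', r', k', T'))"
proof (induction n arbitrary: C r k T)
  case (Suc n)
  let ?M = "{h \<in> T. \<not> (\<exists>h'\<in>T. hcontains \<rho> h h')}"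
  obtain C' r' k' where st: "fold (proc_type A P \<rho>) (sorted_list_of_set ?M) (C, r, k) = (C', r', k')"
    by (rule prod_cases3)
  then have "hstep A P \<rho> (C, r, k, T) = (C', r', k', T - ?M)" by (simp add: hstep_def Let_def)
  then show ?case using Suc[of C' r' k' "T - ?M"] st
    by (simp add: funpow_Suc_right Let_def del: funpow.simps)
qed simp

definition type_slots :: "('i \<Rightarrow> 'h set) \<Rightarrow> ('h \<Rightarrow> nat) \<Rightarrow> 'h list \<Rightarrow> ('i set \<times> nat) list" where
  "type_slots \<rho> \<kappa> hs = map (\<lambda>h. (type_ext \<rho> h, \<kappa> h)) hs"

text \<open>By hierarchy, members of type h chosen before h is processed were chosen under types contained
  in h, so the reduced reservation of h is its original one minus the number of members chosen.\<close>
lemma fold_proc_type: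
  fixes \<rho> :: "'i::finite \<Rightarrow> 'h set"
  assumes hier: "hierarchical \<rho>"
  shows "sorted_wrt (\<lambda>h h'. h \<noteq> h' \<and> \<not> hcontains \<rho> h h') hs \<Longrightarrow> r = q - card C \<Longrightarrow>
    \<forall>h\<in>set hs. k h = \<kappa> h - card (C \<inter> type_ext \<rho> h) \<Longrightarrow>
    \<exists>k'. fold (proc_type A P \<rho>) hs (C, r, k) =
      (let C' = fold (slot_step P q A) (type_slots \<rho> \<kappa> hs) C in (C', q - card C', k'))"
proof (induction hs arbitrary: C r k)
  case (Cons h hs)
  let ?E = "type_ext \<rho> h"
  let ?N = "top_k P (min r (k h)) ((A - C) \<inter> ?E)"
  let ?k = "\<lambda>h'. if hcontains \<rho> h' h then k h' - card ?N else k h'"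
  have N: "?N \<subseteq> (A - C) \<inter> ?E" by (rule top_k_subset)
  have "{i \<in> A - C. h \<in> \<rho> i} = (A - C) \<inter> ?E" by (auto simp: type_ext_def)
  then have proc: "proc_type A P \<rho> h (C, r, k) = (C \<union> ?N, r - card ?N, ?k)"
    unfolding proc_type_def Let_def by (simp only: prod.case)
  have slot: "slot_step P q A (?E, \<kappa> h) C = C \<union> ?N"
    using Cons.prems by (simp add: slot_step_def)
  have "C \<inter> ?N = {}" using N by blast
  then have r: "r - card ?N = q - card (C \<union> ?N)"
    using Cons.prems(2) by (simp add: card_Un_disjoint)
  have k: "?k h' = \<kappa> h' - card ((C \<union> ?N) \<inter> type_ext \<rho> h')" if h': "h' \<in> set hs" for h'
  proof -
    have hh': "h \<noteq> h'" "\<not> hcontains \<rho> h h'" and kh': "k h' = \<kappa> h' - card (C \<inter> type_ext \<rho> h')"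
      using Cons.prems h' by auto
    show ?thesis
    proof (cases "hcontains \<rho> h' h")
      case True
      then have "(C \<union> ?N) \<inter> type_ext \<rho> h' = (C \<inter> type_ext \<rho> h') \<union> ?N"
        using N unfolding hcontains_def by blast
      moreover have "(C \<inter> type_ext \<rho> h') \<inter> ?N = {}" using N by blast
      ultimately show ?thesis using True kh' by (simp add: card_Un_disjoint)
    next
      case False
      then have "?E \<inter> type_ext \<rho> h' = {}"
        using hier hh' unfolding hierarchical_def hcontains_def by blast
      then have "(C \<union> ?N) \<inter> type_ext \<rho> h' = C \<inter> type_ext \<rho> h'" using N by blast
      then show ?thesis using False kh' by simp
    qed
  qed
  have "sorted_wrt (\<lambda>h h'. h \<noteq> h' \<and> \<not> hcontains \<rho> h h') hs" using Cons.prems(1) by simp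
  from Cons.IH[OF this r, of ?k] k show ?case
    by (simp add: proc slot type_slots_def del: if_split)
qed (auto simp: type_slots_def)

text \<open>The final filling by rank becomes one more type, comprising everybody: with reservation
  q, its quota is exactly the remaining capacity.\<close>

definition hchoice_slots :: "('i \<Rightarrow> 'h::{finite,linorder} set) \<Rightarrow> nat \<Rightarrow> ('h \<Rightarrow> nat) \<Rightarrow> ('i set \<times> nat) list" where
  "hchoice_slots \<rho> q \<kappa> =
     type_slots \<rho> \<kappa> (type_order \<rho> (card (UNIV :: 'h set)) UNIV) @ [(UNIV, q)]"

lemma hchoice_eq_slot_run:
  fixes \<rho> :: "'i::finite \<Rightarrow> 'h::{finite,linorder} set"
  assumes hier: "hierarchical \<rho>"
  shows "hchoice A P \<rho> q \<kappa> = slot_run P q (hchoice_slots \<rho> q \<kappa>) A"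
proof -
  let ?hs = "type_order \<rho> (card (UNIV :: 'h set)) UNIV"
  let ?C = "fold (slot_step P q A) (type_slots \<rho> \<kappa> ?hs) {}"
  have run: "slot_run P q (hchoice_slots \<rho> q \<kappa>) A = ?C \<union> top_k P (q - card ?C) (A - ?C)"
    by (simp add: slot_run_def hchoice_slots_def slot_step_def)
  show ?thesis
  proof (cases "\<forall>i\<in>A. \<rho> i = {}")
    \<comment> \<open>The separate branch for untyped applicants agrees with the list: all pools are
      empty until the last entry.\<close>
    case True
    have "slot_step P q A (type_ext \<rho> h, \<kappa> h) {} = {}" for h
      using True by (auto simp: slot_step_def top_k_def type_ext_def)
    then have "fold (slot_step P q A) (type_slots \<rho> \<kappa> hs) {} = {}" for hs
      by (induction hs) (auto simp: type_slots_def)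
    then show ?thesis using run True by (simp add: hchoice_def)
  next
    case False
    have "\<exists>k'. fold (proc_type A P \<rho>) ?hs ({}, q, \<kappa>) = (let C' = ?C in (C', q - card C', k'))"
      by (rule fold_proc_type[OF hier sorted_type_order]) simp_all
    then obtain k' where k': "fold (proc_type A P \<rho>) ?hs ({}, q, \<kappa>) = (?C, q - card ?C, k')"
      by (auto simp: Let_def)
    obtain T' where "(hstep A P \<rho> ^^ card (UNIV :: 'h set)) ({}, q, \<kappa>, UNIV) = (?C, q - card ?C, k', T')"
      using hstep_funpow[where A = A and P = P and \<rho> = \<rho> and n = "card (UNIV :: 'h set)"
          and C = "{}" and r = q and k = \<kappa> and T = UNIV]
      unfolding k' by auto
    then show ?thesis using run by (simp only: hchoice_def False if_False prod.case)
  qed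
qed

lemma nested_hchoice_slots:
  assumes hier: "hierarchical \<rho>"
  shows "nested_order (hchoice_slots \<rho> q \<kappa>)"
proof -
  have "sorted_wrt (\<lambda>h h'. type_ext \<rho> h \<subseteq> type_ext \<rho> h' \<or> type_ext \<rho> h \<inter> type_ext \<rho> h' = {})
      (type_order \<rho> n T)" for n T
    by (rule sorted_wrt_mono_rel[OF _ sorted_type_order])
      (use hier in \<open>auto simp: hierarchical_def hcontains_def\<close>)
  then show ?thesis
    by (auto simp: nested_order_def hchoice_slots_def type_slots_def sorted_wrt_append sorted_wrt_map)
qed

section \<open>Substitutability, size monotonicity and priority of the hierarchical rule\<close>

lemma hchoice_subset:
  fixes \<rho> :: "'i::finite \<Rightarrow> 'h::{finite,linorder} set"
  assumes "hierarchical \<rho>"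
  shows "hchoice A P \<rho> q \<kappa> \<subseteq> A"
  by (simp add: hchoice_eq_slot_run[OF assms] slot_run_subset)

lemma hchoice_mono:
  fixes \<rho> :: "'i::finite \<Rightarrow> 'h::{finite,linorder} set"
  assumes "hierarchical \<rho>" "strict_ranking P" "A \<subseteq> B"
  shows hchoice_substitutes: "hchoice B P \<rho> q \<kappa> \<inter> A \<subseteq> hchoice A P \<rho> q \<kappa>"
    and card_hchoice_mono: "card (hchoice A P \<rho> q \<kappa>) \<le> card (hchoice B P \<rho> q \<kappa>)"
  using slot_run_mono[OF assms(2) nested_hchoice_slots[OF assms(1)] assms(3)]
  unfolding hchoice_eq_slot_run[OF assms(1)] by blast+

text \<open>Substitutability keeps everyone chosen from B, and size monotonicity leaves no room for
  anyone else.\<close>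

lemma hchoice_irrelevance:
  fixes \<rho> :: "'i::finite \<Rightarrow> 'h::{finite,linorder} set"
  assumes "hierarchical \<rho>" "strict_ranking P" "A \<subseteq> B" "hchoice B P \<rho> q \<kappa> \<subseteq> A"
  shows "hchoice A P \<rho> q \<kappa> = hchoice B P \<rho> q \<kappa>"
proof -
  have "hchoice B P \<rho> q \<kappa> \<subseteq> hchoice A P \<rho> q \<kappa>"
    using hchoice_substitutes[OF assms(1-3), of q \<kappa>] assms(4) by blast
  then show ?thesis using card_hchoice_mono[OF assms(1-3)] by (metis card_seteq finite)
qed

lemma hchoice_priority:
  fixes \<rho> :: "'i::finite \<Rightarrow> 'h::{finite,linorder} set"
  assumes "hierarchical \<rho>" "strict_ranking P" "i \<in> hchoice A P \<rho> q \<kappa>"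
    and "j \<in> A" "P j i" "\<rho> i \<subseteq> \<rho> j"
  shows "j \<in> hchoice A P \<rho> q \<kappa>"
  using assms slot_run_priority[OF assms(2), of "hchoice_slots \<rho> q \<kappa>" i j A q]
  unfolding hchoice_eq_slot_run[OF assms(1)]
  by (auto simp: hchoice_slots_def type_slots_def type_ext_def)

section \<open>Cumulative offers under a substitutable and size monotonic choice function\<close>

text \<open>\<open>Ch\<close> acts on the contracts of all institutions at once. It may choose
  several contracts of one individual; that this never happens along an offer process is derived in
  \<open>offers_invariant\<close>.\<close>

locale offer_market =
  fixes ind :: "'x \<Rightarrow> 'i" and Ch :: "'x set \<Rightarrow> 'x set"
  assumes fin: "finite (A :: 'x set)"
    and Ch_subset: "Ch A \<subseteq> A"
    and Ch_substitutes: "A \<subseteq> B \<Longrightarrow> Ch B \<inter> A \<subseteq> Ch A"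
    and Ch_card: "A \<subseteq> B \<Longrightarrow> card (Ch A) \<le> card (Ch B)"
begin

lemma Ch_irrelevance:
  assumes "A \<subseteq> B" "Ch B \<subseteq> A"
  shows "Ch A = Ch B"
proof -
  have "Ch B \<subseteq> Ch A" using Ch_substitutes[OF assms(1)] assms(2) by blast
  then show ?thesis using Ch_card[OF assms(1)] fin by (metis card_seteq)
qed

definition linear_on :: "'x set \<Rightarrow> ('x \<Rightarrow> 'x \<Rightarrow> bool) \<Rightarrow> bool" where
  "linear_on acc bt \<longleftrightarrow> (\<forall>x\<in>acc. \<not> bt x x) \<and>
     (\<forall>x\<in>acc. \<forall>y\<in>acc. \<forall>z\<in>acc. ind x = ind y \<longrightarrow> ind y = ind z \<longrightarrow> bt x y \<longrightarrow> bt y z \<longrightarrow> bt x z) \<and>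
     (\<forall>x\<in>acc. \<forall>y\<in>acc. ind x = ind y \<longrightarrow> x \<noteq> y \<longrightarrow> bt x y \<or> bt y x)"

definition offer :: "'x set \<Rightarrow> ('x \<Rightarrow> 'x \<Rightarrow> bool) \<Rightarrow> 'x set \<Rightarrow> 'x set \<Rightarrow> bool" where
  "offer acc bt A A' \<longleftrightarrow> (\<exists>x. ind x \<notin> ind ` Ch A \<and> x \<in> acc \<and> x \<notin> A \<and>
     (\<forall>y\<in>acc. ind y = ind x \<longrightarrow> y \<notin> A \<longrightarrow> y \<noteq> x \<longrightarrow> bt x y) \<and> A' = insert x A)"

definition final :: "'x set \<Rightarrow> ('x \<Rightarrow> 'x \<Rightarrow> bool) \<Rightarrow> 'x set \<Rightarrow> bool" where
  "final acc bt A \<longleftrightarrow> (offer acc bt)\<^sup>*\<^sup>* {} A \<and> \<not> (\<exists>A'. offer acc bt A A')"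

text \<open>Sets of offers that look like the end of an offer process, except that an individual may have
  several contracts chosen or may have gone on proposing after being accepted.\<close>
definition closed_offers :: "'x set \<Rightarrow> ('x \<Rightarrow> 'x \<Rightarrow> bool) \<Rightarrow> 'x set \<Rightarrow> bool" where
  "closed_offers acc bt B \<longleftrightarrow> B \<subseteq> acc \<and>
     (\<forall>x\<in>B. \<forall>y\<in>acc. ind y = ind x \<longrightarrow> bt y x \<longrightarrow> y \<in> B) \<and>
     (\<forall>x\<in>acc. ind x \<notin> ind ` Ch B \<longrightarrow> x \<in> B)"

lemma linear_on_subset: "linear_on acc bt \<Longrightarrow> acc' \<subseteq> acc \<Longrightarrow> linear_on acc' bt"
  unfolding linear_on_def by (meson subsetD)

lemma best_exists:
  assumes lin: "linear_on acc bt"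
  shows "finite S \<Longrightarrow> S \<noteq> {} \<Longrightarrow> S \<subseteq> acc \<Longrightarrow> \<forall>x\<in>S. ind x = i \<Longrightarrow>
    \<exists>x\<in>S. \<forall>y\<in>S. y \<noteq> x \<longrightarrow> bt x y"
proof (induction S rule: finite_ne_induct)
  case (insert z S)
  then obtain x where x: "x \<in> S" "\<forall>y\<in>S. y \<noteq> x \<longrightarrow> bt x y" by auto
  have mem: "x \<in> acc" "z \<in> acc" "ind x = i" "ind z = i" "x \<noteq> z" using insert x by auto
  then consider "bt x z" | "bt z x" using lin unfolding linear_on_def by metis
  then show ?case
  proof cases
    case 1 then show ?thesis using x by blast
  next
    case 2
    have "bt z y" if "y \<in> S" for y
    proof (cases "y = x")
      case False
      have "y \<in> acc" "ind y = i" using insert that by auto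
      then show ?thesis using lin mem 2 x(2) that False unfolding linear_on_def by metis
    qed (use 2 in simp)
    then show ?thesis by blast
  qed
qed simp

text \<open>A proposer has no chosen contract, and by substitutability the new choice consists of
  old chosen contracts and possibly the new offer, so no individual gets two.\<close>

lemma offers_invariant:
  assumes lin: "linear_on acc bt" and r: "(offer acc bt)\<^sup>*\<^sup>* {} A"
  shows "A \<subseteq> acc \<and> (\<forall>x\<in>A. \<forall>y\<in>acc. ind y = ind x \<longrightarrow> bt y x \<longrightarrow> y \<in> A) \<and> inj_on ind (Ch A)"
  using r
proof (induction rule: rtranclp_induct)
  case base
  show ?case using Ch_subset[of "{}"] by simp
next
  case (step A A')
  then obtain x where x: "ind x \<notin> ind ` Ch A" "x \<in> acc" "x \<notin> A"
    "\<forall>y\<in>acc. ind y = ind x \<longrightarrow> y \<notin> A \<longrightarrow> y \<noteq> x \<longrightarrow> bt x y" and A': "A' = insert x A"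
    unfolding offer_def by blast
  have "y \<in> A" if "y \<in> acc" "ind y = ind x" "bt y x" for y
    using lin x that unfolding linear_on_def by metis
  moreover have "Ch A' \<subseteq> insert x (Ch A)"
    using Ch_substitutes[of A A'] Ch_subset[of A'] A' by blast
  moreover have "inj_on ind (insert x (Ch A))" using step.IH x(1) by auto
  ultimately show ?case using step.IH x(2) A' inj_on_subset by (metis insert_iff insert_subset)
qed

text \<open>Consider a first offer x outside B. Its proposer then has some y chosen from B, and y
  was proposed before x, since otherwise x is better than y and so belongs to B. By substitutability
  y is still chosen from A, so the proposer was not free to propose.\<close>

lemma offers_least:
  assumes lin: "linear_on acc bt" and B: "closed_offers acc bt B" and r: "(offer acc bt)\<^sup>*\<^sup>* {} A"
  shows "A \<subseteq> B"
  using r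
proof (induction rule: rtranclp_induct)
  case (step A A')
  then obtain x where x: "ind x \<notin> ind ` Ch A" "x \<in> acc" "x \<notin> A"
    "\<forall>y\<in>acc. ind y = ind x \<longrightarrow> y \<notin> A \<longrightarrow> y \<noteq> x \<longrightarrow> bt x y" and A': "A' = insert x A"
    unfolding offer_def by blast
  have "x \<in> B"
  proof (rule ccontr)
    assume xB: "x \<notin> B"
    then obtain y where y: "y \<in> Ch B" "ind y = ind x"
      using B x(2) unfolding closed_offers_def by force
    have yB: "y \<in> B" using y Ch_subset by blast
    have "y \<in> A"
    proof (rule ccontr)
      assume "y \<notin> A"
      moreover have "y \<in> acc" "y \<noteq> x" using yB B xB unfolding closed_offers_def by auto
      ultimately have "bt x y" using x y by blast
      then show False using B xB yB x(2) y(2) unfolding closed_offers_def by metis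
    qed
    then have "y \<in> Ch A" using Ch_substitutes[OF step.IH] y by blast
    then show False using x(1) y(2) by (metis imageI)
  qed
  then show ?case using A' step.IH by simp
qed simp

lemma final_closed:
  assumes lin: "linear_on acc bt" and A: "final acc bt A"
  shows "closed_offers acc bt A"
proof -
  have inv: "A \<subseteq> acc \<and> (\<forall>x\<in>A. \<forall>y\<in>acc. ind y = ind x \<longrightarrow> bt y x \<longrightarrow> y \<in> A)"
    using offers_invariant[OF lin] A unfolding final_def by blast
  have "x \<in> A" if x: "x \<in> acc" "ind x \<notin> ind ` Ch A" for x
  proof (rule ccontr)
    assume "x \<notin> A"
    let ?S = "{y \<in> acc. ind y = ind x \<and> y \<notin> A}"
    have "\<exists>z\<in>?S. \<forall>y\<in>?S. y \<noteq> z \<longrightarrow> bt z y"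
      by (rule best_exists[OF lin fin, of _ "ind x"]) (use x \<open>x \<notin> A\<close> in auto)
    then obtain z where "z \<in> ?S" "\<forall>y\<in>?S. y \<noteq> z \<longrightarrow> bt z y" by blast
    then have "offer acc bt A (insert z A)" using x unfolding offer_def by (intro exI[of _ z]) auto
    then show False using A unfolding final_def by blast
  qed
  with inv show ?thesis unfolding closed_offers_def by blast
qed

lemma final_exists: "\<exists>A. final acc bt A"
proof -
  have "(offer acc bt)\<^sup>*\<^sup>* {} A \<Longrightarrow> \<exists>A. final acc bt A" for A
  proof (induction "card (- A)" arbitrary: A rule: less_induct)
    case less
    show ?case
    proof (cases "\<exists>A'. offer acc bt A A'")
      case False
      then show ?thesis using less.prems unfolding final_def by blast
    next
      case True
      then obtain A' where A': "offer acc bt A A'" by blast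
      then have "- A' \<subset> - A" unfolding offer_def by blast
      then have "card (- A') < card (- A)" by (rule psubset_card_mono[OF fin])
      moreover have "(offer acc bt)\<^sup>*\<^sup>* {} A'" using less.prems A' by simp
      ultimately show ?thesis by (rule less.hyps)
    qed
  qed
  then show ?thesis by blast
qed

section \<open>Strategy-proofness by truncation and counting\<close>

lemma final_strategy_proof:
  assumes lin: "linear_on acc bt" and A: "final acc bt A"
    and lin': "linear_on acc' bt'" and A': "final acc' bt' A'"
    and others: "\<And>x. ind x \<noteq> i \<Longrightarrow> x \<in> acc' \<longleftrightarrow> x \<in> acc"
      "\<And>x y. ind x \<noteq> i \<Longrightarrow> bt' x y \<longleftrightarrow> bt x y"
    and w: "w \<in> Ch A'" "ind w = i" "w \<in> acc"
  shows "\<not> (\<forall>x\<in>Ch A. ind x = i \<longrightarrow> bt w x)"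
proof
  assume gain: "\<forall>x\<in>Ch A. ind x = i \<longrightarrow> bt w x"
  \<comment> \<open>\<open>acc1\<close> cuts the true list of i off below w, while
    \<open>acc2\<close> keeps only w; the other individuals are unchanged.\<close>
  define acc1 where "acc1 = {x \<in> acc. ind x = i \<longrightarrow> x = w \<or> bt x w}"
  define acc2 where "acc2 = {x \<in> acc. ind x = i \<longrightarrow> x = w}"
  have lin1: "linear_on acc1 bt" by (rule linear_on_subset[OF lin]) (auto simp: acc1_def)
  have lin2: "linear_on acc2 bt" by (rule linear_on_subset[OF lin]) (auto simp: acc2_def)
  obtain A1 where A1: "final acc1 bt A1" using final_exists by blast
  obtain A2 where A2: "final acc2 bt A2" using final_exists by blast
  note cl = final_closed[OF lin A, unfolded closed_offers_def]
  note cl' = final_closed[OF lin' A', unfolded closed_offers_def]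
  note cl1 = final_closed[OF lin1 A1, unfolded closed_offers_def]
  note cl2 = final_closed[OF lin2 A2, unfolded closed_offers_def]
  have trans: "bt x z" if "bt x y" "bt y z" "ind x = ind y" "ind y = ind z"
    "x \<in> acc" "y \<in> acc" "z \<in> acc" for x y z
    using lin that unfolding linear_on_def by metis
  have irr: "\<not> bt x x" if "x \<in> acc" for x using lin that unfolding linear_on_def by blast

  \<comment> \<open>Otherwise A1 would be closed for the true preferences, so that truth-telling yields w or better.\<close>
  have rejected1: "i \<notin> ind ` Ch A1"
  proof
    assume "i \<in> ind ` Ch A1"
    then obtain y where y: "y \<in> Ch A1" "ind y = i" by blast
    have up: "z \<in> acc1" if "x \<in> A1" "z \<in> acc" "ind z = ind x" "bt z x" for x z
      using that cl1 trans[of z x w] w unfolding acc1_def by auto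
    have "closed_offers acc bt A1"
      unfolding closed_offers_def
    proof (intro conjI ballI impI)
      show "A1 \<subseteq> acc" using cl1 by (auto simp: acc1_def)
      show "z \<in> A1" if "x \<in> A1" "z \<in> acc" "ind z = ind x" "bt z x" for x z
        using that cl1 up[OF that] by blast
      show "x \<in> A1" if "x \<in> acc" "ind x \<notin> ind ` Ch A1" for x
      proof -
        have "ind x \<noteq> i" using that y by (metis imageI)
        then show ?thesis using that cl1 unfolding acc1_def by blast
      qed
    qed
    then have sub: "A \<subseteq> A1" using offers_least[OF lin] A unfolding final_def by blast
    \<comment> \<open>All offers of i in A1 are w or better, whereas \<open>gain\<close> makes w
      better than anything i obtains from A. So i is unmatched in A, must have proposed y there, and
      has y accepted by substitutability.\<close>
    have no: "\<not> (x \<in> Ch A \<and> ind x = i)" for x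
    proof
      assume x: "x \<in> Ch A \<and> ind x = i"
      then have "x \<in> A1" "bt w x" using sub Ch_subset gain by blast+
      then have "x \<in> acc" "x = w \<or> bt x w" using cl1 x unfolding acc1_def by blast+
      then show False using \<open>bt w x\<close> irr[of w] trans[of w x w] x w by auto
    qed
    have "y \<in> acc" using y cl1 Ch_subset[of A1] unfolding acc1_def by blast
    moreover have "ind y \<notin> ind ` Ch A" using no y by force
    ultimately have "y \<in> A" using cl by blast
    then have "y \<in> Ch A" using Ch_substitutes[OF sub] y by blast
    then show False using no y by blast
  qed

  \<comment> \<open>As i is unmatched in A1, dropping its offers other than w changes no choice, and
    the result is closed for \<open>acc2\<close>.\<close>
  define B where "B = {x \<in> A1. ind x = i \<longrightarrow> x = w}"
  have "Ch A1 \<subseteq> B" using rejected1 Ch_subset[of A1] unfolding B_def by blast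
  then have ChB: "Ch B = Ch A1" by (rule Ch_irrelevance[rotated]) (auto simp: B_def)
  have acc21: "acc2 \<subseteq> acc1" "B \<subseteq> acc2"
    using cl1 by (auto simp: acc1_def acc2_def B_def)
  have "closed_offers acc2 bt B"
    unfolding closed_offers_def
  proof (intro conjI ballI impI)
    show "B \<subseteq> acc2" by (rule acc21)
    show "z \<in> B" if "x \<in> B" "z \<in> acc2" "ind z = ind x" "bt z x" for x z
      using that cl1 acc21 unfolding B_def acc2_def by blast
    show "x \<in> B" if "x \<in> acc2" "ind x \<notin> ind ` Ch B" for x
      using that cl1 acc21 unfolding ChB unfolding B_def acc2_def by blast
  qed
  then have sub2: "A2 \<subseteq> B" using offers_least[OF lin2] A2 unfolding final_def by blast

  define B' where "B' = {x \<in> A'. ind x = i \<longrightarrow> x = w}"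
  have inj': "inj_on ind (Ch A')" using offers_invariant[OF lin'] A' unfolding final_def by blast
  have "Ch A' \<subseteq> B'"
    using inj' w Ch_subset[of A'] unfolding B'_def inj_on_def by auto
  then have ChB': "Ch B' = Ch A'" by (rule Ch_irrelevance[rotated]) (auto simp: B'_def)
  have wA': "w \<in> A'" using w Ch_subset by blast
  have "closed_offers acc2 bt B'"
    unfolding closed_offers_def
  proof (intro conjI ballI impI)
    show "B' \<subseteq> acc2" using cl' others w unfolding B'_def acc2_def by blast
    show "z \<in> B'" if "x \<in> B'" "z \<in> acc2" "ind z = ind x" "bt z x" for x z
    proof (cases "ind x = i")
      case True
      then show ?thesis using that wA' by (auto simp: B'_def acc2_def)
    next
      case False
      then have "z \<in> acc'" "bt' z x" "x \<in> A'" using that others by (auto simp: B'_def acc2_def)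
      then have "z \<in> A'" using cl' that(3) by blast
      then show ?thesis using False that(3) by (simp add: B'_def)
    qed
    show "x \<in> B'" if "x \<in> acc2" "ind x \<notin> ind ` Ch B'" for x
    proof -
      have "ind x \<noteq> i" using that w ChB' by (metis imageI)
      then show ?thesis using that cl' others unfolding ChB' unfolding B'_def acc2_def by blast
    qed
  qed
  then have sub2': "A2 \<subseteq> B'" using offers_least[OF lin2] A2 unfolding final_def by blast

  \<comment> \<open>If w is offered, it is chosen by comparison with B'. If not, closedness says
    that i is matched, and w is its only acceptable contract.\<close>
  have wA2: "w \<in> Ch A2"
  proof (cases "w \<in> A2")
    case True
    then show ?thesis using Ch_substitutes[OF sub2'] w ChB' by blast
  next
    case False
    moreover have "w \<in> acc2" using w by (simp add: acc2_def)
    ultimately have "ind w \<in> ind ` Ch A2" using cl2 by blast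
    then obtain y where y: "y \<in> Ch A2" "ind y = i" using w(2) by auto
    then have "y \<in> acc2" using cl2 Ch_subset by blast
    then show ?thesis using y by (simp add: acc2_def)
  qed

  \<comment> \<open>Whoever is served in B is served in A2: the contract is kept by substitutability
    if offered, and if it was never offered its owner is matched. Since i is served in addition, the
    smaller set A2 would yield more contracts than B, against size monotonicity.\<close>
  have "ind ` Ch B \<subseteq> ind ` Ch A2"
  proof
    fix a assume "a \<in> ind ` Ch B"
    then obtain y where y: "y \<in> Ch B" "a = ind y" by blast
    show "a \<in> ind ` Ch A2"
    proof (cases "y \<in> A2")
      case True
      then show ?thesis using y Ch_substitutes[OF sub2] by blast
    next
      case False
      then show ?thesis using y cl2 Ch_subset[of B] acc21 by blast
    qed
  qed
  moreover have "i \<in> ind ` Ch A2" "i \<notin> ind ` Ch B" using wA2 w rejected1 ChB by auto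
  ultimately have "ind ` Ch B \<subset> ind ` Ch A2" by blast
  then have "card (ind ` Ch B) < card (ind ` Ch A2)" by (intro psubset_card_mono finite_imageI fin)
  also have "\<dots> \<le> card (Ch A2)" by (rule card_image_le[OF fin])
  also have "\<dots> \<le> card (Ch B)" by (rule Ch_card[OF sub2])
  also have "\<dots> = card (ind ` Ch B)"
  proof -
    have "inj_on ind (Ch B)"
      using offers_invariant[OF lin1] A1 ChB unfolding final_def by simp
    then show ?thesis by (simp add: card_image)
  qed
  finally show False by simp
qed

end

section \<open>The aggregate rule and its completion\<close>

lemma finite_pos: "finite (UNIV :: pos set)" and set_cat_order: "set cat_order = UNIV"
proof -
  have "v \<in> set cat_order" for v
    \<comment> \<open>The case expression extracts the reserve category of v; \<open>SC\<close> is
      an arbitrary default for \<open>Open\<close>.\<close>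
    by (cases v rule: pos.exhaust; cases "case v of Res c \<Rightarrow> c | Open \<Rightarrow> SC" rule: cat.exhaust)
      (auto simp: cat_order_def)
  then show *: "set cat_order = UNIV" by blast
  show "finite (UNIV :: pos set)" using finite_set[of cat_order] unfolding * .
qed

text \<open>The completion of the aggregate rule: an individual may be chosen by several categories.\<close>
definition cat_choice :: "('s \<Rightarrow> pos \<Rightarrow> nat) \<Rightarrow> ('s \<Rightarrow> pos \<Rightarrow> 'h \<Rightarrow> nat)
    \<Rightarrow> ('s \<Rightarrow> 'i \<Rightarrow> 'i \<Rightarrow> bool) \<Rightarrow> ('i \<Rightarrow> 'h::{finite,linorder} set)
    \<Rightarrow> ('i \<times> 's \<times> pos) set \<Rightarrow> ('i \<times> 's \<times> pos) set" where
  "cat_choice q \<kappa> rk \<rho> Y =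
     {(i, s, v). i \<in> hchoice {i. (i, s, v) \<in> Y} (rk s) \<rho> (q s v) (\<kappa> s v)}"

text \<open>Every pair of institution and category chooses from its own pool, so the properties
  carry over pairwise; sizes add up because the chosen contracts split disjointly over these
  pairs.\<close>

lemma offer_market_cat_choice:
  fixes q :: "'s::finite \<Rightarrow> pos \<Rightarrow> nat" and \<rho> :: "'i::finite \<Rightarrow> 'h::{finite,linorder} set"
  assumes ranking: "\<forall>s. strict_ranking (rk s)" and hier: "hierarchical \<rho>"
  shows "offer_market (cat_choice q \<kappa> rk \<rho>)"
proof
  have rk: "strict_ranking (rk s)" for s using ranking by blast
  let ?H = "\<lambda>(s, v) Y. hchoice {i. (i, s, v) \<in> Y} (rk s) \<rho> (q s v) (\<kappa> s v)"
  have "finite (UNIV :: ('i \<times> 's \<times> pos) set)"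
    using finite_pos by (simp add: finite_prod)
  then show "finite A" for A :: "('i \<times> 's \<times> pos) set" by (rule finite_subset[rotated]) simp
  show "cat_choice q \<kappa> rk \<rho> A \<subseteq> A" for A
    using hchoice_subset[OF hier] by (fastforce simp: cat_choice_def)
  fix A B :: "('i \<times> 's \<times> pos) set" assume AB: "A \<subseteq> B"
  then have sub: "{i. (i, s, v) \<in> A} \<subseteq> {i. (i, s, v) \<in> B}" for s v by blast
  show "cat_choice q \<kappa> rk \<rho> B \<inter> A \<subseteq> cat_choice q \<kappa> rk \<rho> A"
    using hchoice_substitutes[OF hier rk sub] by (fastforce simp: cat_choice_def)
  have card: "card (cat_choice q \<kappa> rk \<rho> Y) = (\<Sum>p\<in>UNIV. card (?H p Y))" for Y
  proof -
    have "bij_betw (\<lambda>((s, v), i). (i, s, v)) (SIGMA p:UNIV. ?H p Y) (cat_choice q \<kappa> rk \<rho> Y)"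
      by (rule bij_betw_byWitness[where f' = "\<lambda>(i, s, v). ((s, v), i)"]) (auto simp: cat_choice_def)
    then have "card (cat_choice q \<kappa> rk \<rho> Y) = card (SIGMA p:UNIV. ?H p Y)"
      by (rule bij_betw_same_card[symmetric])
    also have "\<dots> = (\<Sum>p\<in>UNIV. card (?H p Y))"
      using finite_pos by (intro card_SigmaI) (auto simp: finite_prod)
    finally show ?thesis .
  qed
  show "card (cat_choice q \<kappa> rk \<rho> A) \<le> card (cat_choice q \<kappa> rk \<rho> B)"
    unfolding card using card_hchoice_mono[OF hier rk sub] by (intro sum_mono) auto
qed

text \<open>If nobody is chosen twice, those removed by earlier categories are applicants the
  current one rejects anyway, so \<open>hchoice_irrelevance\<close> applies.\<close>

lemma agg_choice_eq_cat_choice: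
  fixes \<rho> :: "'i::finite \<Rightarrow> 'h::{finite,linorder} set"
  assumes ranking: "\<forall>s. strict_ranking (rk s)" and hier: "hierarchical \<rho>"
    and inj: "inj_on indiv (cat_choice q \<kappa> rk \<rho> Y)"
  shows "agg_choice q \<kappa> rk \<rho> s Y = at_inst (cat_choice q \<kappa> rk \<rho> Y) s"
proof -
  let ?H = "\<lambda>v. hchoice {i. (i, s, v) \<in> Y} (rk s) \<rho> (q s v) (\<kappa> s v)"
  let ?f = "\<lambda>v (D, Z).
       (let Av = {i. (i, s, v) \<in> Y} - D;
            Cv = hchoice Av (rk s) \<rho> (q s v) (\<kappa> s v)
        in (D \<union> Cv, Z \<union> {(i, s, v) | i. i \<in> Cv}))"
  have disj: "?H v \<inter> ?H w = {}" if "v \<noteq> w" for v w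
    using inj that by (fastforce simp: cat_choice_def inj_on_def indiv_def)
  have f: "?f v (D, Z) = (D \<union> ?H v, Z \<union> {(i, s, v) | i. i \<in> ?H v})" if "D \<inter> ?H v = {}" for v D Z
  proof -
    have "?H v \<subseteq> {i. (i, s, v) \<in> Y} - D" using hchoice_subset[OF hier] that by blast
    then have "hchoice ({i. (i, s, v) \<in> Y} - D) (rk s) \<rho> (q s v) (\<kappa> s v) = ?H v"
      using ranking by (intro hchoice_irrelevance[OF hier]) auto
    then show ?thesis by (simp add: Let_def)
  qed
  have "snd (fold ?f vs (D, Z)) = Z \<union> {(i, s, v) | i v. v \<in> set vs \<and> i \<in> ?H v}"
    if "distinct vs" "\<forall>v\<in>set vs. D \<inter> ?H v = {}" for vs D Z
    using that
  proof (induction vs arbitrary: D Z)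
    case (Cons v vs)
    have *: "D \<inter> ?H v = {}" using Cons.prems by simp
    have "(D \<union> ?H v) \<inter> ?H w = {}" if "w \<in> set vs" for w
    proof -
      have "v \<noteq> w" "D \<inter> ?H w = {}" using Cons.prems that by auto
      then show ?thesis using disj[of v w] by blast
    qed
    then have "snd (fold ?f vs (D \<union> ?H v, Z \<union> {(i, s, v) | i. i \<in> ?H v})) =
        Z \<union> {(i, s, v) | i. i \<in> ?H v} \<union> {(i, s, v) | i v. v \<in> set vs \<and> i \<in> ?H v}"
      using Cons.prems by (intro Cons.IH) auto
    then show ?case unfolding fold_simps(2) f[OF *] by auto
  qed simp
  from this[of cat_order "{}" "{}"]
  have "agg_choice q \<kappa> rk \<rho> s Y = {(i, s, v) | i v. i \<in> ?H v}"
    unfolding agg_choice_def set_cat_order by (simp add: cat_order_def)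
  then show ?thesis by (auto simp: at_inst_def cat_choice_def inst_def)
qed

lemma held_agg_choice:
  fixes \<rho> :: "'i::finite \<Rightarrow> 'h::{finite,linorder} set"
  assumes "\<forall>s. strict_ranking (rk s)" "hierarchical \<rho>" "inj_on indiv (cat_choice q \<kappa> rk \<rho> A)"
  shows "held (agg_choice q \<kappa> rk \<rho>) A = cat_choice q \<kappa> rk \<rho> A"
proof -
  have "agg_choice q \<kappa> rk \<rho> s (at_inst A s) = agg_choice q \<kappa> rk \<rho> s A" for s
    by (simp add: agg_choice_def at_inst_def inst_def)
  then show ?thesis
    unfolding held_def by (auto simp: at_inst_def agg_choice_eq_cat_choice[OF assms])
qed

section \<open>The cumulative offer mechanism as an offer process\<close>

definition acceptable where
  "acceptable t Pf = {x \<in> contracts t. Pf (indiv x) (Some (pr x)) None}"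

definition better where
  "better Pf x y \<longleftrightarrow> Pf (indiv x) (Some (pr x)) (Some (pr y))"

lemma contract_eqI: "indiv x = indiv y \<Longrightarrow> pr x = pr y \<Longrightarrow> x = y"
  by (simp add: indiv_def pr_def inst_def ctype_def prod_eq_iff)

lemma asg_eq: "inj_on indiv Y \<Longrightarrow> x \<in> Y \<Longrightarrow> asg Y (indiv x) = Some (pr x)"
proof -
  assume *: "inj_on indiv Y" "x \<in> Y"
  then have "(SOME y. y \<in> Y \<and> indiv y = indiv x) = x"
    by (intro some_equality) (auto dest: inj_onD)
  then show ?thesis using * by (auto simp: asg_def)
qed

lemma asg_None: "i \<notin> indiv ` Y \<Longrightarrow> asg Y i = None"
  by (auto simp: asg_def)

lemma asg_cases:
  assumes "inj_on indiv Y"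
  obtains "asg Y i = None" "i \<notin> indiv ` Y" | x where "x \<in> Y" "indiv x = i" "asg Y i = Some (pr x)"
proof (cases "i \<in> indiv ` Y")
  case True
  then obtain x where "x \<in> Y" "indiv x = i" by blast
  then show ?thesis using that(2)[of x] asg_eq[OF assms, of x] by simp
next
  case False
  then show ?thesis using that(1) asg_None[of i Y] by simp
qed

context
  fixes t :: "'i::finite \<Rightarrow> cat option"
    and q :: "'s::finite \<Rightarrow> pos \<Rightarrow> nat"
    and \<kappa> :: "'s \<Rightarrow> pos \<Rightarrow> 'h::{finite,linorder} \<Rightarrow> nat"
    and rk :: "'s \<Rightarrow> 'i \<Rightarrow> 'i \<Rightarrow> bool"
    and \<rho> :: "'i \<Rightarrow> 'h set"
  assumes ranking: "\<forall>s. strict_ranking (rk s)"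
    and hier: "hierarchical \<rho>"
begin

interpretation offer_market indiv "cat_choice q \<kappa> rk \<rho>"
  by (rule offer_market_cat_choice[OF ranking hier])

abbreviation (input) "Agg \<equiv> agg_choice q \<kappa> rk \<rho>"
abbreviation (input) "Cat \<equiv> cat_choice q \<kappa> rk \<rho>"

lemma linear_on_profile:
  assumes "is_profile t Pf"
  shows "linear_on (acceptable t Pf) (better Pf)"
proof -
  have pref: "is_pref t i (Pf i)" for i using assms by (simp add: is_profile_def)
  have opt: "Some (pr x) \<in> options t (indiv x)" if "x \<in> acceptable t Pf" for x
    using that by (cases x) (auto simp: acceptable_def options_def pr_def indiv_def inst_def ctype_def)
  have "better Pf x y \<or> better Pf y x"
    if "x \<in> acceptable t Pf" "y \<in> acceptable t Pf" "indiv x = indiv y" "x \<noteq> y" for x y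
  proof -
    have "Some (pr x) \<noteq> Some (pr y)" using that contract_eqI by blast
    then show ?thesis using pref[of "indiv x"] opt[OF that(1)] opt[OF that(2)] that(3)
      unfolding is_pref_def better_def by metis
  qed
  moreover have "\<not> better Pf x x" for x using pref unfolding is_pref_def better_def by blast
  moreover have "better Pf x z" if "better Pf x y" "better Pf y z" "indiv x = indiv y" for x y z
    using pref[of "indiv x"] that unfolding is_pref_def better_def by metis
  ultimately show ?thesis unfolding linear_on_def by blast
qed

lemma co_step_eq_offer:
  assumes "inj_on indiv (Cat A)"
  shows "co_step Agg t Pf A A' \<longleftrightarrow> offer (acceptable t Pf) (better Pf) A A'"
proof -
  have best: "best_new t Pf A i x \<longleftrightarrow> indiv x = i \<and> x \<in> acceptable t Pf \<and> x \<notin> A \<and>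
      (\<forall>y\<in>acceptable t Pf. indiv y = indiv x \<longrightarrow> y \<notin> A \<longrightarrow> y \<noteq> x \<longrightarrow> better Pf x y)" for i x
    unfolding best_new_def acceptable_def better_def Ball_def mem_Collect_eq
    by (cases "indiv x = i") (simp_all only: HOL.simp_thms imp_conjL, metis)
  show ?thesis
    unfolding co_step_def offer_def held_agg_choice[OF ranking hier assms] best
    by (auto simp del: split_paired_All split_paired_Ex)
qed

text \<open>Both processes start from the empty set. Along offer runs the completion picks at most
  one contract per individual, so there it equals the held set and the two step relations
  agree.\<close>

lemma co_outcome_iff_final:
  assumes "is_profile t Pf"
  shows "co_outcome Agg t Pf Y \<longleftrightarrow> (\<exists>A. final (acceptable t Pf) (better Pf) A \<and> Y = Cat A)"
proof -
  let ?off = "offer (acceptable t Pf) (better Pf)"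
  have inj: "inj_on indiv (Cat A)" if "?off\<^sup>*\<^sup>* {} A" for A
    using offers_invariant[OF linear_on_profile[OF assms] that] by blast
  have "?off\<^sup>*\<^sup>* {} A" if "(co_step Agg t Pf)\<^sup>*\<^sup>* {} A" for A
    using that
  proof (induction rule: rtranclp_induct)
    case (step A A')
    then have "?off A A'" using co_step_eq_offer[OF inj] by blast
    with step show ?case by simp
  qed simp
  moreover have "(co_step Agg t Pf)\<^sup>*\<^sup>* {} A" if "?off\<^sup>*\<^sup>* {} A" for A
    using that
  proof (induction rule: rtranclp_induct)
    case (step A A')
    then have "co_step Agg t Pf A A'" using co_step_eq_offer[OF inj] by blast
    with step show ?case by simp
  qed simp
  ultimately show ?thesis
    unfolding co_outcome_def final_def
    using inj co_step_eq_offer held_agg_choice[OF ranking hier] by metis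
qed

section \<open>Stability, justified envy and strategy-proofness of the mechanism\<close>

text \<open>An unmatched individual has proposed everything acceptable, and a matched one everything
  better than the contract obtained.\<close>

lemma preferred_contract_offered:
  assumes prof: "is_profile t Pf" and A: "final (acceptable t Pf) (better Pf) A"
    and x: "x \<in> contracts t" "Pf (indiv x) (Some (pr x)) (asg (Cat A) (indiv x))"
  shows "x \<in> A"
proof -
  note lin = linear_on_profile[OF prof]
  have pref: "is_pref t i (Pf i)" for i using prof by (simp add: is_profile_def)
  have inj: "inj_on indiv (Cat A)" using offers_invariant[OF lin] A unfolding final_def by blast
  note cl = final_closed[OF lin A, unfolded closed_offers_def]
  show ?thesis
  proof (cases rule: asg_cases[OF inj, of "indiv x"])
    case 1
    then have "x \<in> acceptable t Pf" using x by (simp add: acceptable_def)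
    then show ?thesis using cl 1 by blast
  next
    case (2 y)
    then have yA: "y \<in> A" using Ch_subset by blast
    then have "y \<in> acceptable t Pf" using cl by blast
    then have "Pf (indiv x) (Some (pr y)) None" using 2 by (simp add: acceptable_def)
    moreover have "Pf (indiv x) (Some (pr x)) (Some (pr y))" using x 2 by simp
    ultimately have "Pf (indiv x) (Some (pr x)) None"
      using pref[of "indiv x"] unfolding is_pref_def by blast
    then have "x \<in> acceptable t Pf" using x by (simp add: acceptable_def)
    moreover have "better Pf x y" using x 2 by (simp add: better_def)
    ultimately show ?thesis using cl yA 2 by metis
  qed
qed

text \<open>All contracts of a blocking set Z have already been proposed, so
  \<open>Cat A \<union> Z\<close> lies between \<open>Cat A\<close> and A. Irrelevance makes the
  choice from it \<open>Cat A\<close> again, which is disjoint from Z.\<close>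

lemma final_stable:
  assumes prof: "is_profile t Pf" and A: "final (acceptable t Pf) (better Pf) A"
  shows "stable Agg t Pf (Cat A)"
proof -
  note lin = linear_on_profile[OF prof]
  have inj: "inj_on indiv (Cat A)" using offers_invariant[OF lin] A unfolding final_def by blast
  have acc: "A \<subseteq> acceptable t Pf" using final_closed[OF lin A] by (simp add: closed_offers_def)
  have sub: "Cat A \<subseteq> A" by (rule Ch_subset)
  have agg: "Agg s B = at_inst (Cat A) s" if "Cat A \<subseteq> B" "B \<subseteq> A" for B s
  proof -
    have "Cat B = Cat A" by (rule Ch_irrelevance[OF that(2,1)])
    then show ?thesis using agg_choice_eq_cat_choice[OF ranking hier, of q \<kappa> B] inj by simp
  qed
  have "is_matching t (Cat A)"
    using inj sub acc unfolding is_matching_def inj_on_def acceptable_def by blast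
  moreover have "asg (Cat A) i = None \<or> Pf i (asg (Cat A) i) None" for i
  proof (cases rule: asg_cases[OF inj, of i])
    case (2 x)
    then have "x \<in> acceptable t Pf" using sub acc by blast
    then show ?thesis using 2 by (simp add: acceptable_def)
  qed simp
  moreover have "Agg s (Cat A) = at_inst (Cat A) s" for s by (rule agg) (use sub in auto)
  moreover have False
    if Z: "Z \<noteq> {}" "Z \<subseteq> contracts t - Cat A" "\<forall>s\<in>inst ` Z. at_inst Z s \<subseteq> Agg s (Cat A \<union> Z)"
      "\<forall>i\<in>indiv ` Z. \<exists>x. {z \<in> Z. indiv z = i} = {x} \<and> Pf i (Some (pr x)) (asg (Cat A) i)" for Z
  proof -
    have "z \<in> A" if z: "z \<in> Z" for z
    proof -
      obtain x where x: "{y \<in> Z. indiv y = indiv z} = {x}"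
        "Pf (indiv z) (Some (pr x)) (asg (Cat A) (indiv z))"
        using bspec[OF Z(4) imageI[OF z]] by blast
      have "z \<in> {y \<in> Z. indiv y = indiv z}" using z by simp
      then have "x = z" using x(1) by simp
      then show ?thesis using preferred_contract_offered[OF prof A, of z] x(2) Z(2) z by blast
    qed
    then have eq: "Agg s (Cat A \<union> Z) = at_inst (Cat A) s" for s
      using sub by (intro agg) auto
    obtain z where z: "z \<in> Z" using Z(1) by blast
    then have "z \<in> at_inst Z (inst z)" by (simp add: at_inst_def)
    then have "z \<in> at_inst (Cat A) (inst z)" using Z(3) z eq[of "inst z"] by blast
    then have "z \<in> Cat A" by (simp add: at_inst_def)
    then show False using Z(2) z by blast
  qed
  ultimately show ?thesis unfolding stable_def by blast
qed

text \<open>The envious j has applied for the same position as i, so by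
  \<open>hchoice_priority\<close> j would hold it too and could not prefer it to its own
  assignment.\<close>

lemma final_no_justified_envy:
  assumes prof: "is_profile t Pf" and A: "final (acceptable t Pf) (better Pf) A"
  shows "no_justified_envy Pf rk \<rho> (Cat A)"
  unfolding no_justified_envy_def
proof (intro allI ballI impI, rule ccontr)
  fix j x
  assume x: "x \<in> Cat A" "indiv x \<noteq> j" and envy: "Pf j (Some (pr x)) (asg (Cat A) j)"
    and neg: "\<not> (rk (inst x) (indiv x) j \<or> \<not> \<rho> (indiv x) \<subseteq> \<rho> j)"
  obtain i s v where x_eq: "x = (i, s, v)" by (cases x)
  note simps = x_eq indiv_def pr_def inst_def ctype_def
  let ?y = "(j, s, v)"
  have "is_pref t j (Pf j)" using prof by (simp add: is_profile_def)
  \<comment> \<open>Preferences compare options only, so the envy itself shows that j is eligible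
    for category v.\<close>
  then have "Some (s, v) \<in> options t j" using envy unfolding is_pref_def by (auto simp: simps)
  then have "?y \<in> contracts t" by (auto simp: options_def)
  then have yA: "?y \<in> A"
    using preferred_contract_offered[OF prof A, of ?y] envy by (simp add: simps)
  have rk: "strict_ranking (rk s)" using ranking by blast
  have "rk s j i" "\<rho> i \<subseteq> \<rho> j" using neg x(2) strict_rankingD(3)[OF rk] by (auto simp: simps)
  then have "?y \<in> Cat A"
    using hchoice_priority[OF hier rk] x(1) yA by (auto simp: simps cat_choice_def)
  moreover have "inj_on indiv (Cat A)"
    using offers_invariant[OF linear_on_profile[OF prof]] A unfolding final_def by blast
  ultimately have "asg (Cat A) j = Some (s, v)"
    using asg_eq[of "Cat A" ?y] by (simp add: simps)
  then show False using envy \<open>is_pref t j (Pf j)\<close> unfolding is_pref_def by (simp add: simps)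
qed

lemma co_outcome_strategy_proof:
  assumes prof: "is_profile t Pf" and P': "is_pref t i P'"
    and Y: "co_outcome Agg t Pf Y" and Y': "co_outcome Agg t (Pf(i := P')) Y'"
  shows "\<not> Pf i (asg Y' i) (asg Y i)"
proof
  assume gain: "Pf i (asg Y' i) (asg Y i)"
  let ?Pf' = "Pf(i := P')"
  have prof': "is_profile t ?Pf'" using prof P' by (simp add: is_profile_def)
  note lin = linear_on_profile[OF prof] and lin' = linear_on_profile[OF prof']
  obtain A where A: "final (acceptable t Pf) (better Pf) A" "Y = Cat A"
    using Y co_outcome_iff_final[OF prof] by blast
  obtain A' where A': "final (acceptable t ?Pf') (better ?Pf') A'" "Y' = Cat A'"
    using Y' co_outcome_iff_final[OF prof'] by blast
  have pref: "is_pref t i (Pf i)" using prof by (simp add: is_profile_def)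
  have tr: "Pf i a b \<Longrightarrow> Pf i b c \<Longrightarrow> Pf i a c" and irr: "\<not> Pf i a a" for a b c
    using pref unfolding is_pref_def by blast+
  have rational: "asg Y i = None \<or> Pf i (asg Y i) None"
    using final_stable[OF prof A(1)] unfolding stable_def A(2) by (elim conjE) (rule spec)
  have inj: "inj_on indiv Y" using offers_invariant[OF lin] A unfolding final_def A(2) by blast
  have inj': "inj_on indiv Y'" using offers_invariant[OF lin'] A' unfolding final_def A'(2) by blast
  \<comment> \<open>Truth-telling is individually rational, so a profitable misreport must yield an
    actual contract w, which is then acceptable under the true preference.\<close>
  have some: "asg Y' i \<noteq> None"
  proof
    assume "asg Y' i = None"
    then show False using gain rational tr[of None "asg Y i" None] irr[of None] by auto
  qed
  then obtain w where w: "w \<in> Y'" "indiv w = i" "asg Y' i = Some (pr w)"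
    using asg_cases[OF inj', of i thesis] by auto
  have "Y' \<subseteq> acceptable t ?Pf'"
    using final_closed[OF lin' A'(1)] Ch_subset A'(2) unfolding closed_offers_def by blast
  then have "w \<in> contracts t" using w(1) by (auto simp: acceptable_def)
  moreover have "Pf i (Some (pr w)) None"
    using w(3) gain rational tr[of "asg Y' i" "asg Y i" None] by auto
  ultimately have acc: "w \<in> acceptable t Pf" using w(2) by (simp add: acceptable_def)
  have "\<not> (\<forall>x\<in>Cat A. indiv x = i \<longrightarrow> better Pf w x)"
  proof (rule final_strategy_proof[OF lin A(1) lin' A'(1) _ _ _ w(2) acc])
    show "w \<in> Cat A'" using w(1) A'(2) by simp
  qed (simp_all add: acceptable_def better_def)
  then obtain x where "x \<in> Y" "indiv x = i" "\<not> better Pf w x" using A(2) by blast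
  then show False using gain w asg_eq[OF inj, of x] by (auto simp: better_def)
qed

lemma co_outcome_exists: "is_profile t Pf \<Longrightarrow> \<exists>Y. co_outcome Agg t Pf Y"
  using final_exists[of "acceptable t Pf" "better Pf"] co_outcome_iff_final[of Pf] by blast

end

text \<open>\<open>co_outcome\<close> is a relation admitting every proposal order. Existence
  prevents vacuity, and the properties hold for whatever orders are used before and after a
  deviation.\<close>

theorem theorem3:
  fixes t :: "'i::finite \<Rightarrow> cat option"
    and q :: "'s::finite \<Rightarrow> pos \<Rightarrow> nat"
    and \<kappa> :: "'s \<Rightarrow> pos \<Rightarrow> 'h::{finite,linorder} \<Rightarrow> nat"
    and rk :: "'s \<Rightarrow> 'i \<Rightarrow> 'i \<Rightarrow> bool"
    and \<rho> :: "'i \<Rightarrow> 'h set"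
  assumes ranking: "\<forall>s. strict_ranking (rk s)"
    and hier: "hierarchical \<rho>"
  shows "(\<forall>Pf. is_profile t Pf \<longrightarrow>
            (\<exists>Y. co_outcome (agg_choice q \<kappa> rk \<rho>) t Pf Y)
          \<and> (\<forall>Y. co_outcome (agg_choice q \<kappa> rk \<rho>) t Pf Y \<longrightarrow>
                 stable (agg_choice q \<kappa> rk \<rho>) t Pf Y \<and> no_justified_envy Pf rk \<rho> Y))
       \<and> (\<forall>Pf i P'. is_profile t Pf \<longrightarrow> is_pref t i P' \<longrightarrow>
            (\<forall>Y Y'. co_outcome (agg_choice q \<kappa> rk \<rho>) t Pf Y \<longrightarrow>
                    co_outcome (agg_choice q \<kappa> rk \<rho>) t (Pf(i := P')) Y' \<longrightarrow>
                    \<not> Pf i (asg Y' i) (asg Y i)))"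
proof (intro conjI allI impI)
  fix Pf :: "'i \<Rightarrow> ('s \<times> pos) option \<Rightarrow> ('s \<times> pos) option \<Rightarrow> bool"
  assume prof: "is_profile t Pf"
  show "\<exists>Y. co_outcome (agg_choice q \<kappa> rk \<rho>) t Pf Y"
    by (rule co_outcome_exists[OF assms prof])
  fix Y assume "co_outcome (agg_choice q \<kappa> rk \<rho>) t Pf Y"
  then obtain A where A: "offer_market.final indiv (cat_choice q \<kappa> rk \<rho>) (acceptable t Pf) (better Pf) A"
    and Y: "Y = cat_choice q \<kappa> rk \<rho> A"
    using co_outcome_iff_final[OF assms prof] by blast
  show "stable (agg_choice q \<kappa> rk \<rho>) t Pf Y"
    unfolding Y by (rule final_stable[OF assms prof A])
  show "no_justified_envy Pf rk \<rho> Y"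
    unfolding Y by (rule final_no_justified_envy[OF assms prof A])
qed (rule co_outcome_strategy_proof[OF assms])

end
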